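(* Let $G$ be a finite group, and let $\mu$ be a shift-invariant Borel probability measure on $G^{\mathbb{N}_0}$ that is also invariant relative to $\tau_G$. Let $\mathcal{B}$ be the Borel $\sigma$-algebra of $G^{\mathbb{N}_0}$. Then $\mu_x^{\sigma^{-1}\mathcal{B}}$, as a measure on $G$, is $\mu$-almost-surely the uniform measure on a right coset of some subgroup $H_{\mu,x}\le G$. The subgroup $H_{\mu,x}$ may depend on $x$, but the map $x\mapsto H_{\mu,x}$ is invariant relative to $\tau_G$ ($\mu$-almost-surely) and is measurable relative to the Pinsker $\sigma$-algebras of both maps $\sigma$ and $\tau_G$ (relative to $\mu$), which are equal.
   Context: $\mathbb{N}_0$ is the set of non-negative integers and $\sigma$ is the left shift on $G^{\mathbb{N}_0}$, $(\sigma(x))_i=x_{i+1}$. $\tau_G:G^{\mathbb{N}_0}\to G^{\mathbb{N}_0}$ is the group multiplication cellular automaton $(\tau_G(x))_i=x_i\cdot x_{i+1}$; $G$ is not necessarily Abelian. A right coset of $H$ is a set of the form $Hg$. For a sub-$\sigma$-algebra $\mathcal{A}\subseteq\mathcal{B}$, $\mu_x^{\mathcal{A}}$ denotes the conditional probability measure of $\mu$ with respect to $\mathcal{A}$ at $x$. The measure $\mu_x^{\sigma^{-1}\mathcal{B}}$ is supported on the atom $\{y:y_i=x_i\text{ for all }i\ge1\}$ and is regarded as a measure on $G$ through $y\mapsto y_0$. $\sigma$-algebras and measurability are understood modulo $\mu$-null sets. *)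

theory Defs
  imports "HOL-Probability.Probability" "HOL-Algebra.Coset"
begin

text \<open>For a finite group the Borel sigma-algebra of the product of discrete spaces is the product
  sigma-algebra, i.e. the one generated by the cylinder sets.\<close>

definition config_space :: "('a, 'b) monoid_scheme \<Rightarrow> (nat \<Rightarrow> 'a) measure" where
  "config_space G = (\<Pi>\<^sub>M i\<in>UNIV. count_space (carrier G))"

definition shift :: "(nat \<Rightarrow> 'a) \<Rightarrow> nat \<Rightarrow> 'a" where
  "shift x = (\<lambda>i. x (Suc i))"

definition group_ca :: "('a, 'b) monoid_scheme \<Rightarrow> (nat \<Rightarrow> 'a) \<Rightarrow> nat \<Rightarrow> 'a" where
  "group_ca G x = (\<lambda>i. x i \<otimes>\<^bsub>G\<^esub> x (Suc i))"

definition measure_preserving :: "'a measure \<Rightarrow> ('a \<Rightarrow> 'a) \<Rightarrow> bool" where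
  "measure_preserving M T \<longleftrightarrow> T \<in> M \<rightarrow>\<^sub>M M \<and> distr M M T = M"

text \<open>\<open>\<kappa> x\<close> is the conditional measure of \<open>M\<close> with respect to the sub-sigma-algebra \<open>F\<close> at \<open>x\<close>.
  Measurability of \<open>x \<mapsto> \<kappa> x B\<close> with respect to \<open>F\<close> modulo null sets follows from the almost sure
  equality with the conditional expectation.\<close>

definition is_conditional_measure ::
    "'a measure \<Rightarrow> 'a measure \<Rightarrow> ('a \<Rightarrow> 'a measure) \<Rightarrow> bool" where
  "is_conditional_measure M F \<kappa> \<longleftrightarrow>
     (AE x in M. prob_space (\<kappa> x) \<and> sets (\<kappa> x) = sets M) \<and>
     (\<forall>B\<in>sets M. AE x in M. measure (\<kappa> x) B = real_cond_exp M F (indicator B) x)"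

text \<open>A finite measurable partition is given by a labelling \<open>X\<close>, whose level sets are its parts.
  The level sets of \<open>itinerary T X n\<close> are the parts of the join of the preimages of that partition
  under \<open>T ^^ i\<close> for \<open>i < n\<close>.\<close>

definition itinerary :: "('a \<Rightarrow> 'a) \<Rightarrow> ('a \<Rightarrow> 'c) \<Rightarrow> nat \<Rightarrow> 'a \<Rightarrow> 'c list" where
  "itinerary T X n x = map (\<lambda>i. X ((T ^^ i) x)) [0..<n]"

definition partition_entropy :: "'a measure \<Rightarrow> ('a \<Rightarrow> 'c) \<Rightarrow> real" where
  "partition_entropy M X = prob_space.entropy M (exp 1) (count_space (X ` space M)) X"

text \<open>The limit exists by subadditivity if \<open>T\<close> preserves \<open>M\<close>.\<close>

definition dynamical_entropy :: "'a measure \<Rightarrow> ('a \<Rightarrow> 'a) \<Rightarrow> ('a \<Rightarrow> 'c) \<Rightarrow> real" where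
  "dynamical_entropy M T X = lim (\<lambda>n. partition_entropy M (itinerary T X n) / real n)"

text \<open>The labelling \<open>\<lambda>x. x \<in> A\<close> is the partition into \<open>A\<close> and its complement. The sets \<open>A\<close> below
  already form a sigma-algebra, which contains all measurable null sets.\<close>

definition pinsker_algebra :: "'a measure \<Rightarrow> ('a \<Rightarrow> 'a) \<Rightarrow> 'a measure" where
  "pinsker_algebra M T =
     sigma (space M) {A \<in> sets M. dynamical_entropy M T (\<lambda>x. x \<in> A) = 0}"

end

theory Submission
  imports Defs
begin

text \<open>Let \<open>\<xi>\<close> be the partition by the symbol at the origin. The \<open>\<sigma>\<close>-itinerary and the \<open>\<tau>\<close>-itinerary of
  length \<open>n\<close> of \<open>\<xi>\<close> determine each other, so \<open>\<xi>\<close> generates under both commuting maps, with the same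
  entropy. If a partition has zero entropy under \<open>\<sigma>\<close>, so do its finite \<open>\<tau>\<close>-joins; these are then
  measurable with respect to every \<open>\<sigma>\<^sup>-\<^sup>m\<B>\<close>, so conditioning on them does not decrease the entropy of
  the \<open>\<xi>\<close>-itinerary, and the \<open>\<tau>\<close>-entropy of the partition must vanish. By symmetry the Pinsker
  algebras agree.

  Let \<open>p\<^sub>x(g)\<close> be the conditional probability of \<open>x\<^sub>0 = g\<close> given \<open>\<sigma>\<^sup>-\<^sup>1\<B>\<close>. Given \<open>\<sigma>\<^sup>-\<^sup>1\<B>\<close>, the
  distribution of \<open>\<tau>(x)\<^sub>0\<close> is the translate \<open>p\<^sub>x(g x\<^sub>1\<^sup>-\<^sup>1)\<close>; given the coarser \<open>\<tau>\<^sup>-\<^sup>1\<sigma>\<^sup>-\<^sup>1\<B>\<close>, it is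
  \<open>p\<^sub>\<tau>\<^sub>x(g)\<close>. Both have the same \<open>L\<^sup>2\<close> norm, summed over \<open>g\<close>, so they coincide. Hence
  \<open>g \<mapsto> p\<^sub>x(g x\<^sub>0)\<close> is \<open>\<tau>\<close>-invariant, thus of zero entropy and \<open>\<sigma>\<^sup>-\<^sup>1\<B>\<close>-measurable: it does not depend on
  the choice of \<open>x\<^sub>0\<close> in the support of \<open>p\<^sub>x\<close>. This forces \<open>p\<^sub>x\<close> to be uniform on a right coset.\<close>

subsection \<open>Entropy of finite partitions\<close>

text \<open>\<open>- ln (cell_prob M X x)\<close> is the information function of the partition. As
  entropy is its integral, partitions with different label types can be compared pointwise.\<close>

definition cell_prob :: "'a measure \<Rightarrow> ('a \<Rightarrow> 'c) \<Rightarrow> 'a \<Rightarrow> real" where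
  "cell_prob M X x = measure M {y \<in> space M. X y = X x}"

lemma neg_mult_ln_le_diff:
  fixes p :: real assumes "0 \<le> p" shows "- (p * ln p) \<le> 1 - p"
proof (cases "p = 0")
  case False
  then have "0 < p" using assms by simp
  then have "- ln p \<le> 1 / p - 1"
    using ln_le_minus_one[of "1 / p"] by (simp add: ln_divide_pos)
  then have "p * - ln p \<le> p * (1 / p - 1)"
    using assms by (rule mult_left_mono)
  also have "\<dots> = 1 - p" using False by (simp add: right_diff_distrib)
  finally show ?thesis by simp
qed simp

text \<open>Writing p = s^2 reduces this to the linear bound for s. A bound that vanishes as p tends
  to 0 is what makes sets of small probability carry little entropy.\<close>

lemma neg_mult_ln_le_sqrt:
  fixes p :: real assumes "0 \<le> p" shows "- (p * ln p) \<le> 2 * sqrt p"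
proof -
  define s where "s = sqrt p"
  have s: "0 \<le> s" and p: "p = s * s" using assms by (auto simp: s_def)
  have "- (p * ln p) = 2 * (s * - (s * ln s))"
  proof (cases "s = 0")
    case False
    then have "ln p = 2 * ln s" using s by (simp add: p ln_mult)
    then show ?thesis by (simp add: p)
  qed (simp add: p)
  also have "\<dots> \<le> 2 * (s * (1 - s))"
    using neg_mult_ln_le_diff[OF s] s by (intro mult_left_mono) auto
  also have "\<dots> \<le> 2 * s"
    using s by (simp add: mult_left_le)
  finally show ?thesis by (simp add: s_def)
qed

context prob_space
begin

lemma integral_simple:
  fixes f :: "'c \<Rightarrow> real"
  assumes "simple_function M X"
  shows "(\<integral>x. f (X x) \<partial>M) = (\<Sum>v\<in>X ` space M. prob (X -` {v} \<inter> space M) * f v)"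
proof -
  have "distributed M (count_space (X ` space M)) X (\<lambda>v. prob (X -` {v} \<inter> space M))"
    by (intro simple_distributed simple_distributedI assms) auto
  from distributed_integral[OF this, of f] show ?thesis
    using assms by (simp add: lebesgue_integral_count_space_finite simple_functionD)
qed

lemma integrable_simple:
  fixes f :: "'c \<Rightarrow> real"
  assumes "simple_function M X"
  shows "integrable M (\<lambda>x. f (X x))"
proof -
  have "simple_function M (\<lambda>x. f (X x))" using simple_function_compose[OF assms, of f] by (simp add: comp_def)
  then have "f \<circ> X \<in> borel_measurable M" "finite ((f \<circ> X) ` space M)"
    by (auto simp: comp_def borel_measurable_simple_function simple_functionD)
  then obtain B where "\<forall>y\<in>(f \<circ> X) ` space M. norm y \<le> B"
    using finite_imp_bounded bounded_iff by meson
  then show ?thesis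
    by (intro integrable_const_bound[of _ B]) (use \<open>f \<circ> X \<in> _\<close> in \<open>auto simp: comp_def\<close>)
qed

lemma simple_function_Collect_mem:
  assumes "simple_function M X" shows "{x \<in> space M. X x \<in> V} \<in> events"
proof -
  have "{x \<in> space M. X x \<in> V} = X -` V \<inter> space M" by auto
  then show ?thesis using simple_functionD(2)[OF assms] by auto
qed

lemma simple_function_Collect_eq:
  assumes "simple_function M X" shows "{x \<in> space M. X x = v} \<in> events"
  using simple_function_Collect_mem[OF assms, of "{v}"] by simp

text \<open>There are finitely many cells, so almost surely no null cell is visited. The
  monotonicity and product rules of the logarithm thus apply almost surely to cell
  probabilities.\<close>

lemma cell_prob_pos:
  assumes "simple_function M X"
  shows "AE x in M. 0 < cell_prob M X x"
proof -
  have "AE x in M. X x = v \<longrightarrow> 0 < cell_prob M X x" for v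
  proof (cases "prob {y \<in> space M. X y = v} = 0")
    case True
    then have "AE x in M. X x \<noteq> v"
      using simple_function_Collect_eq[OF assms, of v] by (subst (asm) prob_eq_0) auto
    then show ?thesis by auto
  next
    case False
    then show ?thesis unfolding cell_prob_def by (intro AE_I2) (auto simp: zero_less_measure_iff)
  qed
  then have "AE x in M. \<forall>v\<in>X ` space M. X x = v \<longrightarrow> 0 < cell_prob M X x"
    using simple_functionD(1)[OF assms] by (intro AE_finite_allI) auto
  then show ?thesis using AE_space by eventually_elim auto
qed

lemma cell_prob_bounds: "0 \<le> cell_prob M X x" "cell_prob M X x \<le> 1"
  by (auto simp: cell_prob_def)

lemma cell_prob_eq: "cell_prob M X x = prob (X -` {X x} \<inter> space M)"
  unfolding cell_prob_def by (rule arg_cong[where f=prob]) auto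

lemma integrable_cell_prob:
  assumes "simple_function M X"
  shows "integrable M (\<lambda>x. f (cell_prob M X x) :: real)"
  using integrable_simple[OF assms, of "\<lambda>v. f (measure M {y \<in> space M. X y = v})"]
  by (simp add: cell_prob_def)

lemma partition_entropy_eq_integral:
  assumes X: "simple_function M X"
  shows "partition_entropy M X = (\<integral>x. - ln (cell_prob M X x) \<partial>M)"
proof -
  interpret information_space M "exp 1" by unfold_locales simp
  have "simple_distributed M X (\<lambda>v. prob (X -` {v} \<inter> space M))"
    by (intro simple_distributedI X) auto
  then have "partition_entropy M X
      = - (\<Sum>v\<in>X ` space M. prob (X -` {v} \<inter> space M) * log (exp 1) (prob (X -` {v} \<inter> space M)))"
    unfolding partition_entropy_def by (rule entropy_simple_distributed)
  also have "\<dots> = (\<Sum>v\<in>X ` space M. prob (X -` {v} \<inter> space M) * - ln (prob (X -` {v} \<inter> space M)))"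
    by (simp add: log_def sum_negf)
  also have "\<dots> = (\<integral>x. - ln (prob (X -` {X x} \<inter> space M)) \<partial>M)"
    by (rule integral_simple[OF X, symmetric])
  finally show ?thesis by (simp add: cell_prob_eq)
qed

lemma partition_entropy_nonneg:
  assumes X: "simple_function M X"
  shows "0 \<le> partition_entropy M X"
proof -
  have "ln (cell_prob M X x) \<le> 0" for x
    using cell_prob_bounds[of X x] by (cases "cell_prob M X x = 0") auto
  then show ?thesis
    unfolding partition_entropy_eq_integral[OF X] by (intro integral_nonneg_AE AE_I2) auto
qed

text \<open>If X refines Y, each cell of X lies in a cell of Y and carries more information.
  Expressing refinement by equality of labels avoids naming a map between the label types.\<close>

lemma partition_entropy_mono:
  assumes X: "simple_function M X" and Y: "simple_function M Y"
    and "\<And>x y. x \<in> space M \<Longrightarrow> y \<in> space M \<Longrightarrow> X x = X y \<Longrightarrow> Y x = Y y"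
  shows "partition_entropy M Y \<le> partition_entropy M X"
  unfolding partition_entropy_eq_integral[OF X] partition_entropy_eq_integral[OF Y]
proof (rule integral_mono_AE)
  show "AE x in M. - ln (cell_prob M Y x) \<le> - ln (cell_prob M X x)"
    using cell_prob_pos[OF X] AE_space
  proof eventually_elim
    case (elim x)
    have "cell_prob M X x \<le> cell_prob M Y x"
      unfolding cell_prob_def using elim
      by (intro finite_measure_mono simple_function_Collect_eq[OF Y]) (auto intro: assms(3))
    then show ?case using elim by simp
  qed
qed (rule integrable_cell_prob[OF X, of "\<lambda>t. - ln t"] integrable_cell_prob[OF Y, of "\<lambda>t. - ln t"])+

lemma partition_entropy_cong_AE:
  assumes X: "simple_function M X" and Y: "simple_function M Y" and eq: "AE x in M. X x = Y x"
  shows "partition_entropy M X = partition_entropy M Y"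
  unfolding partition_entropy_eq_integral[OF X] partition_entropy_eq_integral[OF Y]
proof (rule integral_cong_AE)
  show "AE x in M. - ln (cell_prob M X x) = - ln (cell_prob M Y x)"
    using eq
  proof eventually_elim
    case (elim x)
    have "prob {y \<in> space M. X y = X x} = prob {y \<in> space M. Y y = Y x}"
      using eq simple_function_Collect_eq[OF X] simple_function_Collect_eq[OF Y] elim
      by (intro finite_measure_eq_AE) auto
    then show ?case by (simp add: cell_prob_def)
  qed
qed (rule borel_measurable_integrable, rule integrable_cell_prob[OF X, of "\<lambda>t. - ln t"] integrable_cell_prob[OF Y, of "\<lambda>t. - ln t"])+

lemma cell_prob_compose:
  assumes T: "measure_preserving M T" and X: "simple_function M X"
  shows "cell_prob M (\<lambda>x. X (T x)) x = cell_prob M X (T x)"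
proof -
  have [measurable]: "T \<in> M \<rightarrow>\<^sub>M M" and D: "distr M M T = M"
    using T by (auto simp: measure_preserving_def)
  have "cell_prob M X (T x) = measure (distr M M T) {y \<in> space M. X y = X (T x)}"
    unfolding cell_prob_def D ..
  also have "\<dots> = measure M (T -` {y \<in> space M. X y = X (T x)} \<inter> space M)"
    by (intro measure_distr simple_function_Collect_eq[OF X]) simp
  also have "T -` {y \<in> space M. X y = X (T x)} \<inter> space M = {y \<in> space M. X (T y) = X (T x)}"
    using measurable_space[of T M M] by auto
  finally show ?thesis by (simp add: cell_prob_def)
qed

lemma partition_entropy_compose:
  assumes T: "measure_preserving M T" and X: "simple_function M X"
  shows "partition_entropy M (\<lambda>x. X (T x)) = partition_entropy M X"
proof -
  have [measurable]: "T \<in> M \<rightarrow>\<^sub>M M" and D: "distr M M T = M"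
    using T by (auto simp: measure_preserving_def)
  have "(\<integral>x. - ln (cell_prob M X x) \<partial>distr M M T) = (\<integral>x. - ln (cell_prob M X (T x)) \<partial>M)"
    using borel_measurable_integrable[OF integrable_cell_prob[OF X, of "\<lambda>t. - ln t"]]
    by (intro integral_distr) auto
  then show ?thesis
    using simple_function_comp[of T M M, OF _ X]
    by (simp add: partition_entropy_eq_integral X cell_prob_compose T D)
qed

text \<open>This is nonnegativity of the conditional mutual information of X and Y given Z, which
  equals H(X,Z) + H(Y,Z) - H(X,Y,Z) - H(Z).\<close>

lemma partition_entropy_submodular_Pair:
  assumes X: "simple_function M X" and Y: "simple_function M Y" and Z: "simple_function M Z"
  shows "partition_entropy M (\<lambda>x. (X x, Y x, Z x)) + partition_entropy M Z
    \<le> partition_entropy M (\<lambda>x. (X x, Z x)) + partition_entropy M (\<lambda>x. (Y x, Z x))"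
proof -
  interpret information_space M "exp 1" by unfold_locales simp
  let ?W = "\<lambda>x. (X x, Y x, Z x)" and ?XZ = "\<lambda>x. (X x, Z x)" and ?YZ = "\<lambda>x. (Y x, Z x)"
  have W: "simple_function M ?W" and XZ: "simple_function M ?XZ" and YZ: "simple_function M ?YZ"
    by (intro simple_function_Pair X Y Z)+
  define dW where "dW = (\<lambda>v. prob (?W -` {v} \<inter> space M))"
  define dXZ where "dXZ = (\<lambda>v. prob (?XZ -` {v} \<inter> space M))"
  define dYZ where "dYZ = (\<lambda>v. prob (?YZ -` {v} \<inter> space M))"
  define dZ where "dZ = (\<lambda>v. prob (Z -` {v} \<inter> space M))"
  note d = dW_def dXZ_def dYZ_def dZ_def
  define F where "F = (\<lambda>(a, b, c). ln (dW (a, b, c) / (dXZ (a, c) * (dYZ (b, c) / dZ c))))"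
  have sd: "simple_distributed M ?W dW" "simple_distributed M ?XZ dXZ"
      "simple_distributed M ?YZ dYZ" "simple_distributed M Z dZ"
    unfolding d by (intro simple_distributedI W XZ YZ Z; simp)+
  have "0 \<le> conditional_mutual_information (exp 1) (count_space (X ` space M))
      (count_space (Y ` space M)) (count_space (Z ` space M)) X Y Z"
    by (rule conditional_mutual_information_nonneg[OF X Y Z])
  also have "\<dots> = (\<Sum>(a, b, c)\<in>?W ` space M. dW (a, b, c) *
      log (exp 1) (dW (a, b, c) / (dXZ (a, c) * (dYZ (b, c) / dZ c))))"
    by (rule conditional_mutual_information_eq[OF sd(4,3,2,1)])
  also have "\<dots> = (\<Sum>v\<in>?W ` space M. dW v * F v)"
    by (intro sum.cong) (auto simp: log_def F_def)
  also have "\<dots> = (\<integral>x. F (?W x) \<partial>M)"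
    unfolding dW_def by (rule integral_simple[OF W, symmetric])
  also have "\<dots> = (\<integral>x. (ln (cell_prob M ?W x) + ln (cell_prob M Z x))
      - (ln (cell_prob M ?XZ x) + ln (cell_prob M ?YZ x)) \<partial>M)"
  proof (rule integral_cong_AE)
    show "AE x in M. F (?W x) = (ln (cell_prob M ?W x) + ln (cell_prob M Z x))
      - (ln (cell_prob M ?XZ x) + ln (cell_prob M ?YZ x))"
      using cell_prob_pos[OF W] cell_prob_pos[OF XZ] cell_prob_pos[OF YZ] cell_prob_pos[OF Z]
      by eventually_elim (simp add: cell_prob_eq d F_def ln_div ln_mult)
  next
    show "(\<lambda>x. F (?W x)) \<in> borel_measurable M"
      by (rule borel_measurable_integrable[OF integrable_simple[OF W]])
  next
    show "(\<lambda>x. ln (cell_prob M ?W x) + ln (cell_prob M Z x)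
      - (ln (cell_prob M ?XZ x) + ln (cell_prob M ?YZ x))) \<in> borel_measurable M"
      using integrable_cell_prob[OF W, of ln] integrable_cell_prob[OF XZ, of ln]
        integrable_cell_prob[OF YZ, of ln] integrable_cell_prob[OF Z, of ln]
      by (intro borel_measurable_diff borel_measurable_add borel_measurable_integrable)
  qed
  also have "\<dots> = (partition_entropy M ?XZ + partition_entropy M ?YZ)
      - (partition_entropy M ?W + partition_entropy M Z)"
    using integrable_cell_prob[OF W, of ln] integrable_cell_prob[OF XZ, of ln]
      integrable_cell_prob[OF YZ, of ln] integrable_cell_prob[OF Z, of ln]
    by (simp add: partition_entropy_eq_integral W XZ YZ Z)
  finally show ?thesis by simp
qed

text \<open>Read as H(U) - H(V) <= H(W) - H(Z): what W adds to V is at most what W adds to the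
  coarser Z. The later estimates of conditional entropies are mostly instances of this form.\<close>

lemma partition_entropy_submodular:
  assumes U: "simple_function M U" and Z: "simple_function M Z"
    and V: "simple_function M V" and W: "simple_function M W"
    and VW: "\<And>x y. x \<in> space M \<Longrightarrow> y \<in> space M \<Longrightarrow> V x = V y \<Longrightarrow> W x = W y \<Longrightarrow> U x = U y"
    and VZ: "\<And>x y. x \<in> space M \<Longrightarrow> y \<in> space M \<Longrightarrow> V x = V y \<Longrightarrow> Z x = Z y"
    and WZ: "\<And>x y. x \<in> space M \<Longrightarrow> y \<in> space M \<Longrightarrow> W x = W y \<Longrightarrow> Z x = Z y"
  shows "partition_entropy M U + partition_entropy M Z \<le> partition_entropy M V + partition_entropy M W"
proof -
  have "partition_entropy M U \<le> partition_entropy M (\<lambda>x. (V x, W x, Z x))"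
    by (intro partition_entropy_mono simple_function_Pair U V W Z) (auto intro: VW)
  moreover have "partition_entropy M (\<lambda>x. (V x, Z x)) \<le> partition_entropy M V"
    by (intro partition_entropy_mono simple_function_Pair U V W Z) (auto intro: VZ)
  moreover have "partition_entropy M (\<lambda>x. (W x, Z x)) \<le> partition_entropy M W"
    by (intro partition_entropy_mono simple_function_Pair U V W Z) (auto intro: WZ)
  ultimately show ?thesis
    using partition_entropy_submodular_Pair[OF V W Z] by linarith
qed

lemma partition_entropy_const: "partition_entropy M (\<lambda>x. c) = 0"
  by (simp add: partition_entropy_eq_integral cell_prob_def prob_space)

lemma partition_entropy_subadditive:
  assumes U: "simple_function M U" and V: "simple_function M V" and W: "simple_function M W"
    and "\<And>x y. x \<in> space M \<Longrightarrow> y \<in> space M \<Longrightarrow> V x = V y \<Longrightarrow> W x = W y \<Longrightarrow> U x = U y"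
  shows "partition_entropy M U \<le> partition_entropy M V + partition_entropy M W"
proof -
  have "partition_entropy M U + partition_entropy M (\<lambda>_. ()) \<le> partition_entropy M V + partition_entropy M W"
    by (rule partition_entropy_submodular[OF U simple_function_const V W assms(4)]) auto
  then show ?thesis by (simp add: partition_entropy_const)
qed

lemma simple_function_mem:
  assumes D: "D \<in> events" shows "simple_function M (\<lambda>x. x \<in> D)"
proof -
  have "simple_function M (\<lambda>x. indicator D x = (1::real))"
    using simple_function_compose1[OF simple_function_indicator[OF D], of "\<lambda>t. t = (1::real)"] by simp
  then show ?thesis by (simp add: indicator_eq_1_iff)
qed

text \<open>The square root bound handles D and the linear bound its complement, so the entropy
  tends to 0 with the probability of D.\<close>

lemma partition_entropy_set_le:
  assumes D: "D \<in> events"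
  shows "partition_entropy M (\<lambda>x. x \<in> D) \<le> 2 * sqrt (prob D) + prob D"
proof -
  have "- ln (cell_prob M (\<lambda>x. x \<in> D) x)
      = indicator D x * - ln (prob D) + indicator (space M - D) x * - ln (1 - prob D)"
    if "x \<in> space M" for x
  proof (cases "x \<in> D")
    case True
    then have "{y \<in> space M. (y \<in> D) = (x \<in> D)} = D" using sets.sets_into_space[OF D] by auto
    then show ?thesis using True by (simp add: cell_prob_def)
  next
    case False
    then have "{y \<in> space M. (y \<in> D) = (x \<in> D)} = space M - D" using sets.sets_into_space[OF D] by auto
    then show ?thesis using False that by (simp add: cell_prob_def prob_compl D)
  qed
  then have "partition_entropy M (\<lambda>x. x \<in> D)
      = (\<integral>x. indicator D x * - ln (prob D) + indicator (space M - D) x * - ln (1 - prob D) \<partial>M)"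
    unfolding partition_entropy_eq_integral[OF simple_function_mem[OF D]]
    by (intro Bochner_Integration.integral_cong) auto
  also have "\<dots> = prob D * - ln (prob D) + (1 - prob D) * - ln (1 - prob D)"
  proof -
    have "integrable M (\<lambda>x. indicator D x :: real)" "integrable M (\<lambda>x. indicator (space M - D) x :: real)"
      using D by (simp_all add: integrable_indicator_iff emeasure_eq_measure)
    then show ?thesis
      using D by (subst Bochner_Integration.integral_add) (simp_all add: prob_compl)
  qed
  also have "\<dots> \<le> 2 * sqrt (prob D) + prob D"
    using neg_mult_ln_le_sqrt[of "prob D"] neg_mult_ln_le_diff[of "1 - prob D"] by simp
  finally show ?thesis .
qed

end

subsection \<open>Itineraries and dynamical entropy\<close>

lemma measure_preserving_space:
  "measure_preserving M T \<Longrightarrow> x \<in> space M \<Longrightarrow> T x \<in> space M"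
  by (auto simp: measure_preserving_def dest: measurable_space)

lemma measure_preserving_compose:
  assumes "measure_preserving M S" "measure_preserving M T"
  shows "measure_preserving M (S \<circ> T)"
proof -
  have [measurable]: "S \<in> M \<rightarrow>\<^sub>M M" "T \<in> M \<rightarrow>\<^sub>M M" and eq: "distr M M S = M" "distr M M T = M"
    using assms by (auto simp: measure_preserving_def)
  have "distr M M (S \<circ> T) = distr (distr M M T) M S"
    by (rule distr_distr[symmetric]) auto
  then show ?thesis by (simp add: measure_preserving_def eq)
qed

lemma measure_preserving_funpow:
  assumes "measure_preserving M T" shows "measure_preserving M (T ^^ n)"
proof (induction n)
  case 0
  show ?case by (simp add: measure_preserving_def distr_id[unfolded id_def] id_def)
next
  case (Suc n)
  then show ?case using measure_preserving_compose[OF assms] by (simp only: funpow.simps)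
qed

lemma itinerary_0: "itinerary T X 0 x = []"
  by (simp add: itinerary_def)

lemma itinerary_Suc: "itinerary T X (Suc n) x = X x # itinerary T X n (T x)"
  unfolding itinerary_def upt_conv_Cons[OF zero_less_Suc] map_Suc_upt[symmetric]
  by (simp add: funpow_swap1)

lemma itinerary_eq_iff:
  "itinerary T X n x = itinerary T X n y \<longleftrightarrow> (\<forall>i<n. X ((T ^^ i) x) = X ((T ^^ i) y))"
  by (auto simp: itinerary_def)

lemma itinerary_eq_SucD:
  "itinerary T X (Suc n) x = itinerary T X (Suc n) y \<Longrightarrow> itinerary T X n x = itinerary T X n y"
  by (auto simp: itinerary_eq_iff)

lemma simple_function_itinerary:
  assumes T: "measure_preserving M T" and X: "simple_function M X"
  shows "simple_function M (itinerary T X n)"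
proof (induction n)
  case 0
  then show ?case by (simp add: itinerary_0[abs_def])
next
  case (Suc n)
  have "simple_function M (\<lambda>x. itinerary T X n (T x))"
    using T Suc by (intro simple_function_comp[of T M M]) (auto simp: measure_preserving_def)
  then show ?case
    unfolding itinerary_Suc[abs_def] by (rule simple_function_compose2[OF X])
qed

lemma simple_function_compose_measure_preserving:
  assumes T: "measure_preserving M T" and X: "simple_function M X"
  shows "simple_function M (\<lambda>x. X (T x))"
  using T by (intro simple_function_comp[OF _ X]) (simp add: measure_preserving_def)

lemma Cesaro_mean_tendsto:
  fixes u :: "nat \<Rightarrow> real"
  assumes u: "u \<longlonglongrightarrow> l"
  shows "(\<lambda>n. (\<Sum>k<n. u k) / real n) \<longlonglongrightarrow> l"
proof (rule LIMSEQ_I)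
  fix e :: real assume e: "0 < e"
  obtain N where N: "\<And>k. N \<le> k \<Longrightarrow> norm (u k - l) < e / 2"
    using LIMSEQ_D[OF u, of "e / 2"] e by auto
  define C where "C = (\<Sum>k<N. \<bar>u k - l\<bar>)"
  obtain N' where N': "2 * C / e < real N'" using reals_Archimedean2 by blast
  have "norm ((\<Sum>k<n. u k) / real n - l) < e" if "Suc (max N N') \<le> n" for n
  proof -
    have n: "0 < n" "N \<le> n" "N' < n" using that by auto
    have "\<bar>\<Sum>k<n. u k - l\<bar> \<le> (\<Sum>k<n. \<bar>u k - l\<bar>)" by (rule sum_abs)
    also have "\<dots> = C + (\<Sum>k=N..<n. \<bar>u k - l\<bar>)"
      unfolding C_def using n by (simp add: sum.atLeastLessThan_concat lessThan_atLeast0)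
    also have "(\<Sum>k=N..<n. \<bar>u k - l\<bar>) \<le> (\<Sum>k=N..<n. e / 2)"
      using N by (intro sum_mono) (auto intro: less_imp_le)
    also have "\<dots> \<le> real n * (e / 2)"
      using e n by (simp add: field_simps)
    finally have "\<bar>\<Sum>k<n. u k - l\<bar> \<le> C + real n * (e / 2)" by simp
    also have "C < real n * (e / 2)"
    proof -
      have "2 * C / e < real n" using N' n by linarith
      then show ?thesis using e by (simp add: field_simps)
    qed
    finally have lt: "\<bar>\<Sum>k<n. u k - l\<bar> < e * real n" by (simp add: mult.commute)
    have eq: "(\<Sum>k<n. u k) / real n - l = (\<Sum>k<n. u k - l) / real n"
      using n by (simp add: sum_subtractf field_simps)
    show ?thesis
      unfolding eq real_norm_def abs_divide using lt n by (simp add: pos_divide_less_eq)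
  qed
  then show "\<exists>no. \<forall>n\<ge>no. norm ((\<Sum>k<n. u k) / real n - l) < e" by blast
qed

context prob_space
begin

context
  fixes T :: "'a \<Rightarrow> 'a" and X :: "'a \<Rightarrow> 'c"
  assumes T: "measure_preserving M T" and X: "simple_function M X"
begin

lemma itinerary_entropy_0: "partition_entropy M (itinerary T X 0) = 0"
  using partition_entropy_const[of "[]"] by (simp add: itinerary_0[abs_def])

lemma simple_function_itinerary_shift: "simple_function M (\<lambda>x. itinerary T X n (T x))"
  by (rule simple_function_compose_measure_preserving[OF T simple_function_itinerary[OF T X]])

lemma partition_entropy_itinerary_shift:
  "partition_entropy M (\<lambda>x. itinerary T X n (T x)) = partition_entropy M (itinerary T X n)"
  by (rule partition_entropy_compose[OF T simple_function_itinerary[OF T X]])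

text \<open>The increments are the entropies of one symbol given the n following ones. They decrease
  by submodularity, hence converge, and the quotients defining the dynamical entropy are their
  Cesaro means. So the \<open>lim\<close> in its definition is a genuine limit.\<close>

lemma itinerary_entropy_increment:
  defines "a \<equiv> \<lambda>n. partition_entropy M (itinerary T X (Suc n)) - partition_entropy M (itinerary T X n)"
  shows "a \<longlonglongrightarrow> dynamical_entropy M T X"
    and "(\<lambda>n. partition_entropy M (itinerary T X n) / real n) \<longlonglongrightarrow> dynamical_entropy M T X"
    and "dynamical_entropy M T X \<le> a n"
proof -
  note sX = simple_function_itinerary[OF T X]
  have "decseq a"
  proof (rule decseq_SucI)
    fix n
    \<comment> \<open>The time windows [0, n+1) and [1, n+2) cover [0, n+2) and overlap in [1,
      n+1).\<close>
    have "partition_entropy M (itinerary T X (Suc (Suc n))) + partition_entropy M (\<lambda>x. itinerary T X n (T x))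
      \<le> partition_entropy M (itinerary T X (Suc n)) + partition_entropy M (\<lambda>x. itinerary T X (Suc n) (T x))"
      by (intro partition_entropy_submodular sX simple_function_itinerary_shift)
        ((auto simp: itinerary_Suc)[2], auto dest: itinerary_eq_SucD)
    then show "a (Suc n) \<le> a n"
      by (simp add: a_def partition_entropy_itinerary_shift)
  qed
  moreover have "0 \<le> a n" for n
    unfolding a_def diff_ge_0_iff_ge
    by (intro partition_entropy_mono sX) (auto simp: itinerary_eq_iff)
  ultimately obtain l where l: "a \<longlonglongrightarrow> l" "\<And>n. l \<le> a n"
    using decseq_convergent[of a 0] by blast
  have "partition_entropy M (itinerary T X n) = (\<Sum>k<n. a k)" for n
    by (induction n) (auto simp: a_def itinerary_entropy_0)
  then have lim: "(\<lambda>n. partition_entropy M (itinerary T X n) / real n) \<longlonglongrightarrow> l"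
    using Cesaro_mean_tendsto[OF l(1)] by simp
  then have "dynamical_entropy M T X = l"
    unfolding dynamical_entropy_def by (rule limI)
  then show "a \<longlonglongrightarrow> dynamical_entropy M T X"
    and "(\<lambda>n. partition_entropy M (itinerary T X n) / real n) \<longlonglongrightarrow> dynamical_entropy M T X"
    and "dynamical_entropy M T X \<le> a n"
    using l lim by auto
qed

lemma dynamical_entropy_mult_le:
  "real m * dynamical_entropy M T X
    \<le> partition_entropy M (itinerary T X (m + n)) - partition_entropy M (itinerary T X n)"
proof (induction m)
  case (Suc m)
  then show ?case using itinerary_entropy_increment(3)[of "m + n"] by (simp add: algebra_simps)
qed simp

end

text \<open>With \<open>\<alpha>\<close>, \<open>\<beta>\<close> the partitions into the level sets of \<open>A\<close>, \<open>B\<close>, the chain rule gives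
  \<open>H(\<alpha>\<^sub>n, \<beta>\<^sub>n) \<le> H(\<beta>\<^sub>n) + (\<Sum>k<n. H(\<alpha> | \<beta>, T\<^sup>-\<^sup>1\<alpha>\<^sub>k))\<close>. Dividing by \<open>n\<close> shows that, given the future of
  \<open>\<alpha>\<close>, the partitions \<open>\<alpha>\<close> and \<open>\<beta>\<close> are independent; but \<open>\<beta>\<close> is determined by \<open>\<alpha>\<close> and this future.\<close>

lemma zero_entropy_conditional_on_future:
  assumes T: "measure_preserving M T" and A: "simple_function M A" and B: "simple_function M B"
    and zero: "(\<lambda>n. partition_entropy M (itinerary T B n) / real n) \<longlonglongrightarrow> 0"
    and gen: "(\<lambda>n. partition_entropy M (\<lambda>x. (B x, itinerary T A n x))
      - partition_entropy M (itinerary T A n)) \<longlonglongrightarrow> 0"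
  shows "(\<lambda>n. partition_entropy M (\<lambda>x. (B x, itinerary T A n (T x)))
      - partition_entropy M (itinerary T A n)) \<longlonglongrightarrow> 0"
proof -
  note sA = simple_function_itinerary[OF T A] and sB = simple_function_itinerary[OF T B]
  note sA' = simple_function_itinerary_shift[OF T A] and sB' = simple_function_itinerary_shift[OF T B]
  note simple = simple_function_Pair sA sB sA' sB' A B
  define h where "h = dynamical_entropy M T A"
  \<comment> \<open>With A_n for the n-step itinerary, \<open>a n\<close> is H(A | T^-1 A_n) and
    \<open>b n\<close> is H(A | B, T^-1 A_n).\<close>
  define a where "a n = partition_entropy M (itinerary T A (Suc n)) - partition_entropy M (itinerary T A n)" for n
  define b where "b n = partition_entropy M (\<lambda>x. (B x, itinerary T A (Suc n) x))
    - partition_entropy M (\<lambda>x. (B x, itinerary T A n (T x)))" for n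
  have "decseq b"
  proof (rule decseq_SucI)
    fix n
    have "partition_entropy M (\<lambda>x. (B x, itinerary T A (Suc (Suc n)) x))
        + partition_entropy M (\<lambda>x. (B x, itinerary T A n (T x)))
      \<le> partition_entropy M (\<lambda>x. (B x, itinerary T A (Suc n) x))
        + partition_entropy M (\<lambda>x. (B x, itinerary T A (Suc n) (T x)))"
      by (intro partition_entropy_submodular simple)
        ((auto simp: itinerary_Suc)[2], auto dest: itinerary_eq_SucD)
    then show "b (Suc n) \<le> b n" by (simp add: b_def)
  qed
  moreover have "0 \<le> b n" for n
    unfolding b_def diff_ge_0_iff_ge
    by (intro partition_entropy_mono simple) (auto simp: itinerary_Suc)
  ultimately obtain l where l: "b \<longlonglongrightarrow> l"
    using decseq_convergent[of b 0] by blast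
  have chain: "partition_entropy M (\<lambda>x. (itinerary T A n x, itinerary T B n x))
      \<le> partition_entropy M (itinerary T B n) + (\<Sum>k<n. b k)" for n
  proof (induction n)
    case 0
    show ?case by (simp add: itinerary_0[abs_def] partition_entropy_const)
  next
    case (Suc n)
    \<comment> \<open>Starting from the pair T^-1 A_n, T^-1 B_n, adding B costs at most H(B_(n+1)) -
      H(B_n). Then adding A costs at most \<open>b n\<close>, since T^-1 B_n is only an additional
      condition.\<close>
    have "partition_entropy M (\<lambda>x. (itinerary T A (Suc n) x, itinerary T B (Suc n) x))
        + partition_entropy M (\<lambda>x. (B x, itinerary T A n (T x)))
      \<le> partition_entropy M (\<lambda>x. (B x, itinerary T A (Suc n) x))
        + partition_entropy M (\<lambda>x. (itinerary T B (Suc n) x, itinerary T A n (T x)))"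
      by (intro partition_entropy_submodular simple) (auto simp: itinerary_Suc)
    moreover have "partition_entropy M (\<lambda>x. (itinerary T B (Suc n) x, itinerary T A n (T x)))
        + partition_entropy M (\<lambda>x. itinerary T B n (T x))
      \<le> partition_entropy M (itinerary T B (Suc n))
        + partition_entropy M (\<lambda>x. (itinerary T A n (T x), itinerary T B n (T x)))"
      by (intro partition_entropy_submodular simple) (auto simp: itinerary_Suc)
    moreover have "partition_entropy M (\<lambda>x. (itinerary T A n (T x), itinerary T B n (T x)))
      = partition_entropy M (\<lambda>x. (itinerary T A n x, itinerary T B n x))"
      by (rule partition_entropy_compose[OF T]) (intro simple)
    ultimately show ?case
      using Suc partition_entropy_itinerary_shift[OF T B, of n] by (simp add: b_def)
  qed
  \<comment> \<open>After division by n, the first summand of \<open>chain\<close> vanishes in the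
    limit because B has zero entropy, and the Cesaro mean of b tends to l.\<close>
  have "h \<le> 0 + l"
  proof (rule LIMSEQ_le)
    show "(\<lambda>n. partition_entropy M (itinerary T A n) / real n) \<longlonglongrightarrow> h"
      unfolding h_def by (rule itinerary_entropy_increment(2)[OF T A])
    show "(\<lambda>n. partition_entropy M (itinerary T B n) / real n + (\<Sum>k<n. b k) / real n) \<longlonglongrightarrow> 0 + l"
      by (intro tendsto_add zero Cesaro_mean_tendsto l)
    have "partition_entropy M (itinerary T A n) / real n
        \<le> partition_entropy M (itinerary T B n) / real n + (\<Sum>k<n. b k) / real n" for n
    proof -
      have "partition_entropy M (itinerary T A n)
          \<le> partition_entropy M (\<lambda>x. (itinerary T A n x, itinerary T B n x))"
        by (intro partition_entropy_mono simple) auto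
      then show ?thesis using chain[of n] by (simp add: divide_right_mono flip: add_divide_distrib)
    qed
    then show "\<exists>N. \<forall>n\<ge>N. partition_entropy M (itinerary T A n) / real n
        \<le> partition_entropy M (itinerary T B n) / real n + (\<Sum>k<n. b k) / real n" by blast
  qed
  define d where "d n = partition_entropy M (\<lambda>x. (B x, itinerary T A n (T x)))
      - partition_entropy M (itinerary T A n)" for n
  have "a \<longlonglongrightarrow> h"
    unfolding a_def[abs_def] h_def by (rule itinerary_entropy_increment(1)[OF T A])
  \<comment> \<open>By telescoping, \<open>d n\<close> is the term of \<open>gen\<close> at n+1 plus
    \<open>a n - b n\<close>. So h - l is a limit of nonnegative numbers, while h <= l was just
    shown.\<close>
  then have "(\<lambda>n. (partition_entropy M (\<lambda>x. (B x, itinerary T A (Suc n) x))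
      - partition_entropy M (itinerary T A (Suc n))) + (a n - b n)) \<longlonglongrightarrow> 0 + (h - l)"
    by (intro tendsto_add tendsto_diff l LIMSEQ_Suc[OF gen])
  then have lim: "d \<longlonglongrightarrow> h - l"
    by (simp add: a_def b_def d_def[abs_def])
  moreover have "0 \<le> d n" for n
  proof -
    have "partition_entropy M (\<lambda>x. itinerary T A n (T x))
        \<le> partition_entropy M (\<lambda>x. (B x, itinerary T A n (T x)))"
      by (intro partition_entropy_mono simple) auto
    then show ?thesis by (simp add: d_def partition_entropy_itinerary_shift[OF T A])
  qed
  ultimately have "0 \<le> h - l"
    by (intro LIMSEQ_le_const[of d]) auto
  with \<open>h \<le> 0 + l\<close> have "h - l = 0" by simp
  with lim show ?thesis by (simp add: d_def[abs_def])
qed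

subsection \<open>Generating partitions\<close>

lemma partition_entropy_eqI:
  assumes X: "simple_function M X" and Y: "simple_function M Y"
    and "\<And>x y. x \<in> space M \<Longrightarrow> y \<in> space M \<Longrightarrow> X x = X y \<longleftrightarrow> Y x = Y y"
  shows "partition_entropy M X = partition_entropy M Y"
  using assms(3) by (intro antisym partition_entropy_mono X Y) blast+

text \<open>The events whose conditional entropy given the n-step itinerary tends to 0 form a
  sigma-algebra. It contains the generating events, whose conditional entropy is 0 from some n on.
  Countable unions are approximated by finite ones.\<close>

lemma conditional_entropy_tendsto_0_generator:
  assumes T: "measure_preserving M T" and X: "simple_function M X"
    and gen: "events = sigma_sets (space M) {{x \<in> space M. X ((T ^^ i) x) = v} | i v. True}"
    and A: "A \<in> events"
  shows "(\<lambda>n. partition_entropy M (\<lambda>x. (x \<in> A, itinerary T X n x)) - partition_entropy M (itinerary T X n)) \<longlonglongrightarrow> 0"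
proof -
  define d where "d A n = partition_entropy M (\<lambda>x. (x \<in> A, itinerary T X n x))
    - partition_entropy M (itinerary T X n)" for A n
  note sX = simple_function_itinerary[OF T X]
  note simple = simple_function_Pair simple_function_mem sX
  have nonneg: "0 \<le> d A n" if "A \<in> events" for A n
    unfolding d_def diff_ge_0_iff_ge using that by (intro partition_entropy_mono simple) auto
  have d_le: "d A n \<le> d B n"
    if "A \<in> events" "B \<in> events"
      and "\<And>x y. x \<in> space M \<Longrightarrow> y \<in> space M \<Longrightarrow> itinerary T X n x = itinerary T X n y \<Longrightarrow>
        (x \<in> B) = (y \<in> B) \<Longrightarrow> (x \<in> A) = (y \<in> A)" for A B n
    unfolding d_def
  proof (intro diff_right_mono partition_entropy_mono simple that(1,2))
    fix x y assume xy: "x \<in> space M" "y \<in> space M"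
      and eq: "(x \<in> B, itinerary T X n x) = (y \<in> B, itinerary T X n y)"
    have "(x \<in> A) = (y \<in> A)"
      using eq by (intro that(3)[OF xy]) auto
    then show "(x \<in> A, itinerary T X n x) = (y \<in> A, itinerary T X n y)"
      using eq by auto
  qed
  have empty: "d {} n = 0" for n
    unfolding d_def right_minus_eq by (intro partition_entropy_eqI simple) auto
  have union: "d (A \<union> B) n \<le> d A n + d B n" if "A \<in> events" "B \<in> events" for A B n
  proof -
    have "partition_entropy M (\<lambda>x. (x \<in> A \<union> B, itinerary T X n x)) + partition_entropy M (itinerary T X n)
      \<le> partition_entropy M (\<lambda>x. (x \<in> A, itinerary T X n x)) + partition_entropy M (\<lambda>x. (x \<in> B, itinerary T X n x))"
      using that by (intro partition_entropy_submodular simple) auto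
    then show ?thesis by (simp add: d_def)
  qed
  have "A \<in> sigma_sets (space M) {{x \<in> space M. X ((T ^^ i) x) = v} | i v. True}"
    using A gen by simp
  then have "d A \<longlonglongrightarrow> 0"
  proof (induction A rule: sigma_sets.induct)
    case (Basic A)
    then obtain i v where A: "A = {x \<in> space M. X ((T ^^ i) x) = v}" by auto
    have "A \<in> events" using Basic gen by auto
    have "d A n = 0" if "i < n" for n
    proof -
      have "d A n \<le> d {} n"
        using \<open>A \<in> events\<close> that by (intro d_le) (auto simp: A itinerary_eq_iff)
      then show ?thesis using nonneg[OF \<open>A \<in> events\<close>, of n] empty[of n] by simp
    qed
    then have "\<forall>\<^sub>F n in sequentially. d A n = 0"
      by (auto intro: eventually_sequentiallyI[of "Suc i"])
    then show ?case by (simp add: tendsto_eventually)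
  next
    case Empty
    then show ?case by (simp add: empty[abs_def] tendsto_eventually)
  next
    case (Compl A)
    have "A \<in> events" using Compl gen by auto
    then have "d (space M - A) n \<le> d A n" for n
      by (intro d_le) auto
    then show ?case
      using nonneg \<open>A \<in> events\<close> by (intro tendsto_sandwich[OF _ _ tendsto_const Compl.IH] always_eventually) auto
  next
    case (Union A)
    have A: "A i \<in> events" for i using Union gen by auto
    define B where "B k = (\<Union>i<k. A i)" for k
    have B: "B k \<in> events" for k using A by (auto simp: B_def)
    have dB: "d (B k) \<longlonglongrightarrow> 0" for k
    proof (induction k)
      case 0
      then show ?case by (simp add: B_def empty[abs_def] tendsto_eventually)
    next
      case (Suc k)
      have "B (Suc k) = B k \<union> A k" by (auto simp: B_def less_Suc_eq)
      moreover have "(\<lambda>n. d (B k) n + d (A k) n) \<longlonglongrightarrow> 0"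
        using tendsto_add[OF Suc Union.IH[of k]] by simp
      ultimately show ?case
        using nonneg[OF B] union[OF B A]
        by (intro tendsto_sandwich[OF _ _ tendsto_const \<open>(\<lambda>n. d (B k) n + d (A k) n) \<longlonglongrightarrow> 0\<close>] always_eventually)
          (metis, metis)
    qed
    define U where "U = (\<Union>i. A i)"
    have U: "U \<in> events" using A by (auto simp: U_def)
    define p where "p k = prob (U - B k)" for k
    have "(\<lambda>k. prob (B k)) \<longlonglongrightarrow> prob (\<Union>k. B k)"
    proof (rule finite_Lim_measure_incseq)
      show "incseq B" unfolding B_def by (intro monoI UN_mono) auto
    qed (use B in auto)
    moreover have "(\<Union>k. B k) = U" by (auto simp: B_def U_def)
    moreover have "p = (\<lambda>k. prob U - prob (B k))"
    proof
      fix k show "p k = prob U - prob (B k)"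
        unfolding p_def using B U by (intro finite_measure_Diff) (auto simp: B_def U_def)
    qed
    ultimately have "p \<longlonglongrightarrow> 0"
      using tendsto_diff[OF tendsto_const, of "\<lambda>k. prob (B k)" "prob U" sequentially "prob U"] by simp
    then have "(\<lambda>k. 2 * sqrt (p k) + p k) \<longlonglongrightarrow> 2 * sqrt 0 + 0"
      by (intro tendsto_intros)
    then have lim: "(\<lambda>k. 2 * sqrt (p k) + p k) \<longlonglongrightarrow> 0" by simp
    \<comment> \<open>\<open>B k\<close> and the remainder \<open>U - B k\<close> together determine
      U, and the remainder has small entropy because its probability \<open>p k\<close> is
      small.\<close>
    have le: "d U n \<le> d (B k) n + (2 * sqrt (p k) + p k)" for n k
    proof -
      have "partition_entropy M (\<lambda>x. (x \<in> U, itinerary T X n x))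
        \<le> partition_entropy M (\<lambda>x. (x \<in> B k, itinerary T X n x)) + partition_entropy M (\<lambda>x. x \<in> U - B k)"
        using U B by (intro partition_entropy_subadditive simple) (auto simp: B_def U_def)
      also have "partition_entropy M (\<lambda>x. x \<in> U - B k) \<le> 2 * sqrt (p k) + p k"
        unfolding p_def using U B by (intro partition_entropy_set_le) auto
      finally show ?thesis by (simp add: d_def)
    qed
    have "d U \<longlonglongrightarrow> 0"
    proof (rule LIMSEQ_I)
      fix e :: real assume e: "0 < e"
      have "\<forall>\<^sub>F k in sequentially. 2 * sqrt (p k) + p k < e / 2"
        using e by (intro order_tendstoD(2)[OF lim]) simp
      then obtain k where k: "2 * sqrt (p k) + p k < e / 2"
        unfolding eventually_sequentially by blast
      have "\<forall>\<^sub>F n in sequentially. d (B k) n < e / 2"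
        using e by (intro order_tendstoD(2)[OF dB]) simp
      then obtain N where N: "\<And>n. N \<le> n \<Longrightarrow> d (B k) n < e / 2"
        unfolding eventually_sequentially by blast
      have "norm (d U n - 0) < e" if "N \<le> n" for n
        using le[of n k] k N[OF that] nonneg[OF U, of n] by simp
      then show "\<exists>no. \<forall>n\<ge>no. norm (d U n - 0) < e" by blast
    qed
    then show ?case by (simp add: U_def)
  qed
  then show ?thesis by (simp add: d_def[abs_def])
qed

lemma conditional_entropy_tendsto_0_simple:
  assumes Y: "\<And>n. simple_function M (Y n)"
    and sets: "\<And>A. A \<in> events \<Longrightarrow>
      (\<lambda>n. partition_entropy M (\<lambda>x. (x \<in> A, Y n x)) - partition_entropy M (Y n)) \<longlonglongrightarrow> 0"
    and B: "simple_function M B"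
  shows "(\<lambda>n. partition_entropy M (\<lambda>x. (B x, Y n x)) - partition_entropy M (Y n)) \<longlonglongrightarrow> 0"
proof -
  define f where "f V x = (if B x \<in> V then Some (B x) else None)" for V x
  have f: "simple_function M (f V)" for V
    unfolding f_def using simple_function_compose1[OF B] by fast
  have "(\<lambda>n. partition_entropy M (\<lambda>x. (f V x, Y n x)) - partition_entropy M (Y n)) \<longlonglongrightarrow> 0"
    if "finite V" for V
    using that
  proof (induction V)
    case empty
    have "partition_entropy M (\<lambda>x. (f {} x, Y n x)) = partition_entropy M (Y n)" for n
      by (intro partition_entropy_eqI simple_function_Pair f Y) (auto simp: f_def)
    then show ?case by simp
  next
    case (insert v V)
    let ?A = "{x \<in> space M. B x = v}"
    have A: "?A \<in> events" by (rule simple_function_Collect_eq[OF B])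
    show ?case
    proof (rule tendsto_sandwich[OF _ _ tendsto_const])
      show "(\<lambda>n. (partition_entropy M (\<lambda>x. (f V x, Y n x)) - partition_entropy M (Y n))
          + (partition_entropy M (\<lambda>x. (x \<in> ?A, Y n x)) - partition_entropy M (Y n))) \<longlonglongrightarrow> 0"
        using tendsto_add[OF insert.IH sets[OF A]] by simp
      have "partition_entropy M (Y n) \<le> partition_entropy M (\<lambda>x. (f (insert v V) x, Y n x))" for n
        by (intro partition_entropy_mono simple_function_Pair f Y) auto
      then show "\<forall>\<^sub>F n in sequentially. 0 \<le> partition_entropy M (\<lambda>x. (f (insert v V) x, Y n x)) - partition_entropy M (Y n)"
        by simp
      have "partition_entropy M (\<lambda>x. (f (insert v V) x, Y n x)) + partition_entropy M (Y n)
          \<le> partition_entropy M (\<lambda>x. (f V x, Y n x)) + partition_entropy M (\<lambda>x. (x \<in> ?A, Y n x))" for n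
        by (intro partition_entropy_submodular simple_function_Pair f Y simple_function_mem A)
          (auto simp: f_def split: if_splits)
      then show "\<forall>\<^sub>F n in sequentially. partition_entropy M (\<lambda>x. (f (insert v V) x, Y n x)) - partition_entropy M (Y n)
          \<le> (partition_entropy M (\<lambda>x. (f V x, Y n x)) - partition_entropy M (Y n))
          + (partition_entropy M (\<lambda>x. (x \<in> ?A, Y n x)) - partition_entropy M (Y n))"
        by (intro always_eventually allI) (smt (verit))
    qed
  qed
  from this[OF simple_functionD(1)[OF B]]
  show ?thesis
  proof (rule Lim_transform_eventually, intro always_eventually allI)
    fix n
    have "partition_entropy M (\<lambda>x. (f (B ` space M) x, Y n x)) = partition_entropy M (\<lambda>x. (B x, Y n x))"
      by (intro partition_entropy_eqI simple_function_Pair f Y B) (auto simp: f_def)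
    then show "partition_entropy M (\<lambda>x. (f (B ` space M) x, Y n x)) - partition_entropy M (Y n)
      = partition_entropy M (\<lambda>x. (B x, Y n x)) - partition_entropy M (Y n)" by simp
  qed
qed

text \<open>Majority vote: C consists of the cells of Y of which A fills more than half. A point
  where A and C differ lies in a part with conditional probability t <= 1/2 in its cell, where the
  conditional information -ln t is at least 1 - t >= 1/2. Integration gives the factor 2.\<close>

lemma measurable_approximation_conditional_entropy:
  assumes sub: "subalgebra M F" and Y: "simple_function F Y" and A: "A \<in> events"
  shows "\<exists>C\<in>sets F. prob {x \<in> space M. (x \<in> A) \<noteq> (x \<in> C)}
    \<le> 2 * (partition_entropy M (\<lambda>x. (x \<in> A, Y x)) - partition_entropy M Y)"
proof -
  have sp: "space F = space M" and subset: "sets F \<subseteq> events"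
    using sub by (auto simp: subalgebra_def)
  have YM: "simple_function M Y"
    using Y sp subset unfolding simple_function_def by auto
  have AY: "simple_function M (\<lambda>x. (x \<in> A, Y x))"
    by (intro simple_function_Pair simple_function_mem A YM)
  define V where "V = {v. prob {y \<in> space M. Y y = v} < 2 * prob {y \<in> space M. y \<in> A \<and> Y y = v}}"
  define C where "C = {x \<in> space M. Y x \<in> V}"
  have "C = Y -` V \<inter> space F" by (auto simp: C_def sp)
  then have C: "C \<in> sets F" using simple_functionD(2)[OF Y] by simp
  let ?D = "{x \<in> space M. (x \<in> A) \<noteq> (x \<in> C)}"
  have "?D = (A - C) \<union> (C - A)" using sets.sets_into_space[OF A] by (auto simp: C_def)
  then have D: "?D \<in> events" using A C subset by auto
  have sA: "{y \<in> space M. y \<in> A \<and> Y y = v} \<in> events" for v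
  proof -
    have "{y \<in> space M. y \<in> A \<and> Y y = v} = A \<inter> {y \<in> space M. Y y = v}" by auto
    then show ?thesis using A simple_function_Collect_eq[OF YM, of v] by auto
  qed
  have split: "prob {y \<in> space M. Y y = v} = prob {y \<in> space M. y \<in> A \<and> Y y = v} + prob {y \<in> space M. y \<notin> A \<and> Y y = v}" for v
  proof -
    have "{y \<in> space M. y \<notin> A \<and> Y y = v} = {y \<in> space M. Y y = v} - {y \<in> space M. y \<in> A \<and> Y y = v}" by auto
    moreover have "{y \<in> space M. y \<in> A \<and> Y y = v} \<subseteq> {y \<in> space M. Y y = v}" by auto
    ultimately show ?thesis
      using finite_measure_Diff[OF simple_function_Collect_eq[OF YM, of v] sA[of v]] by simp
  qed
  let ?g = "\<lambda>x. 2 * (ln (cell_prob M Y x) - ln (cell_prob M (\<lambda>x. (x \<in> A, Y x)) x))"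
  have int: "integrable M (\<lambda>x. ln (cell_prob M Y x))" "integrable M (\<lambda>x. ln (cell_prob M (\<lambda>x. (x \<in> A, Y x)) x))"
    by (rule integrable_cell_prob[OF YM, of ln], rule integrable_cell_prob[OF AY, of ln])
  have "prob ?D = (\<integral>x. indicator ?D x \<partial>M)" using D by simp
  also have "\<dots> \<le> (\<integral>x. ?g x \<partial>M)"
  proof (rule integral_mono_AE)
    show "integrable M (indicator ?D :: 'a \<Rightarrow> real)"
      using D by (simp add: integrable_indicator_iff emeasure_eq_measure)
    show "integrable M ?g" using int by simp
    show "AE x in M. indicator ?D x \<le> ?g x"
      using cell_prob_pos[OF YM] cell_prob_pos[OF AY] AE_space
    proof eventually_elim
      case (elim x)
      define p q where "p = cell_prob M (\<lambda>x. (x \<in> A, Y x)) x" and "q = cell_prob M Y x"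
      have pq: "0 < p" "0 < q" using elim by (auto simp: p_def q_def)
      have p: "p = (if x \<in> A then prob {y \<in> space M. y \<in> A \<and> Y y = Y x} else prob {y \<in> space M. y \<notin> A \<and> Y y = Y x})"
        by (simp add: p_def cell_prob_def)
      have q: "q = prob {y \<in> space M. Y y = Y x}" by (simp add: q_def cell_prob_def)
      have "p \<le> q" using split[of "Y x"] by (auto simp: p q)
      have "x \<in> C \<longleftrightarrow> q < 2 * prob {y \<in> space M. y \<in> A \<and> Y y = Y x}"
        using elim by (auto simp: C_def V_def q)
      then have "2 * p \<le> q" if "x \<in> ?D"
        using that split[of "Y x"] by (auto simp: p q split: if_splits)
      moreover have "1 - p / q \<le> - ln (p / q)"
        using ln_le_minus_one[of "p / q"] pq by simp
      moreover have "- ln (p / q) = ln q - ln p" using pq by (simp add: ln_div)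
      moreover have "p / q \<le> 1" using \<open>p \<le> q\<close> pq by simp
      moreover have "p / q \<le> 1 / 2" if "2 * p \<le> q" using that pq by (simp add: field_simps)
      ultimately show ?case
        unfolding p_def[symmetric] q_def[symmetric] by (cases "x \<in> ?D") (simp_all, linarith?)
    qed
  qed
  also have "\<dots> = 2 * (partition_entropy M (\<lambda>x. (x \<in> A, Y x)) - partition_entropy M Y)"
    using int by (simp add: partition_entropy_eq_integral YM AY)
  finally show ?thesis using C by blast
qed

text \<open>Errors of at most (1/2)^k are summable, so by Borel-Cantelli almost every point is
  classified correctly by all but finitely many approximations. Their limsup lies in F and agrees
  with A almost surely.\<close>

lemma AE_measurable_of_conditional_entropy_tendsto_0:
  assumes sub: "subalgebra M F" and Y: "\<And>n. simple_function F (Y n)" and A: "A \<in> events"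
    and lim: "(\<lambda>n. partition_entropy M (\<lambda>x. (x \<in> A, Y n x)) - partition_entropy M (Y n)) \<longlonglongrightarrow> 0"
  shows "\<exists>A'\<in>sets F. AE x in M. x \<in> A \<longleftrightarrow> x \<in> A'"
proof -
  have sp: "space F = space M" and subset: "sets F \<subseteq> events"
    using sub by (auto simp: subalgebra_def)
  have "\<exists>C\<in>sets F. prob {x \<in> space M. (x \<in> A) \<noteq> (x \<in> C)} \<le> (1 / 2) ^ k" for k :: nat
  proof -
    have "\<forall>\<^sub>F n in sequentially. partition_entropy M (\<lambda>x. (x \<in> A, Y n x)) - partition_entropy M (Y n) < (1 / 2) ^ k / 2"
      by (rule order_tendstoD(2)[OF lim]) simp
    then obtain n where "partition_entropy M (\<lambda>x. (x \<in> A, Y n x)) - partition_entropy M (Y n) < (1 / 2) ^ k / 2"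
      unfolding eventually_sequentially by blast
    moreover obtain C where "C \<in> sets F" "prob {x \<in> space M. (x \<in> A) \<noteq> (x \<in> C)}
        \<le> 2 * (partition_entropy M (\<lambda>x. (x \<in> A, Y n x)) - partition_entropy M (Y n))"
      using measurable_approximation_conditional_entropy[OF sub Y[of n] A] by blast
    ultimately show ?thesis by (intro bexI[of _ C]) auto
  qed
  then obtain C where C: "\<And>k. C k \<in> sets F" "\<And>k. prob {x \<in> space M. (x \<in> A) \<noteq> (x \<in> C k)} \<le> (1 / 2) ^ k"
    by metis
  define D where "D k = {x \<in> space M. (x \<in> A) \<noteq> (x \<in> C k)}" for k
  have "D k = (A - C k) \<union> (C k - A)" for k
    using sets.sets_into_space[OF A] sets.sets_into_space[OF C(1), of k] by (auto simp: D_def sp)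
  moreover have "C k \<in> events" for k using C(1) subset by auto
  ultimately have D: "D k \<in> events" for k using A by simp
  have "prob (D k) \<le> (1 / 2) ^ k" for k unfolding D_def by (rule C(2))
  then have "summable (\<lambda>k. prob (D k))"
    by (intro summable_comparison_test'[OF summable_geometric[of "1 / 2 :: real"], of 0]) auto
  then have "AE x in M. \<forall>\<^sub>F k in sequentially. x \<in> space M - D k"
    using D by (intro borel_cantelli_AE1) (auto simp: emeasure_eq_measure)
  moreover have "x \<in> A \<longleftrightarrow> x \<in> (\<Inter>m. \<Union>k\<in>{m..}. C k)"
    if ev: "\<forall>\<^sub>F k in sequentially. x \<in> space M - D k" for x
  proof -
    from ev obtain N where N: "\<And>k. N \<le> k \<Longrightarrow> x \<in> A \<longleftrightarrow> x \<in> C k"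
      unfolding eventually_sequentially D_def by auto
    show ?thesis
    proof
      assume "x \<in> A"
      show "x \<in> (\<Inter>m. \<Union>k\<in>{m..}. C k)"
      proof
        fix m
        have "x \<in> C (max m N)" using \<open>x \<in> A\<close> N[of "max m N"] by simp
        then show "x \<in> (\<Union>k\<in>{m..}. C k)" by (intro UN_I[of "max m N"]) auto
      qed
    next
      assume "x \<in> (\<Inter>m. \<Union>k\<in>{m..}. C k)"
      then show "x \<in> A" using N by blast
    qed
  qed
  moreover have "(\<Inter>m. \<Union>k\<in>{m..}. C k) \<in> sets F"
    using C(1) by (intro sets.countable_INT) auto
  ultimately show ?thesis by (intro bexI[of _ "\<Inter>m. \<Union>k\<in>{m..}. C k"]) auto
qed

subsection \<open>Zero entropy for commuting maps with a common generator\<close>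

text \<open>Division with remainder: j + m * i with j < m and i < n runs through all times below m *
  n.\<close>

lemma itinerary_funpow_eq_iff:
  assumes "0 < m"
  shows "itinerary (S ^^ m) (itinerary S A m) n x = itinerary (S ^^ m) (itinerary S A m) n y
    \<longleftrightarrow> itinerary S A (m * n) x = itinerary S A (m * n) y"
proof -
  have "(\<forall>i<n. \<forall>j<m. P (j + m * i)) \<longleftrightarrow> (\<forall>k<m * n. P k)" for P
  proof safe
    fix k assume P: "\<forall>i<n. \<forall>j<m. P (j + m * i)" and k: "k < m * n"
    have "k div m < n" using k assms by (simp add: less_mult_imp_div_less mult.commute)
    moreover have "k mod m < m" using assms by simp
    ultimately have "P (k mod m + m * (k div m))" using P by blast
    then show "P k" by simp
  next
    fix i j assume P: "\<forall>k<m * n. P k" and "i < n" "j < m"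
    have "j + m * i < m * Suc i" using \<open>j < m\<close> by simp
    also have "\<dots> \<le> m * n" using \<open>i < n\<close> by (intro mult_le_mono2) simp
    finally show "P (j + m * i)" using P by blast
  qed
  note this[of "\<lambda>k. A ((S ^^ k) x) = A ((S ^^ k) y)"]
  then show ?thesis
    by (simp add: itinerary_eq_iff funpow_mult funpow_add mult.commute)
qed

lemma commute_funpow:
  assumes "S \<in> M \<rightarrow>\<^sub>M M" "\<And>x. x \<in> space M \<Longrightarrow> S (T x) = T (S x)" "x \<in> space M"
  shows "(S ^^ i) x \<in> space M" "(S ^^ i) (T x) = T ((S ^^ i) x)"
proof -
  show "(S ^^ i) x \<in> space M" for i
    using assms(1,3) by (induction i) (auto dest: measurable_space)
  then show "(S ^^ i) (T x) = T ((S ^^ i) x)"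
    by (induction i) (auto simp: assms(2))
qed

text \<open>By commutation, the S-itinerary of B composed with T^j is the S-itinerary of B at T^j x.
  As T preserves the measure, each of the m layers of the T-join has the same entropy.\<close>

lemma entropy_itinerary_of_itinerary_le:
  assumes S: "measure_preserving M S" and T: "measure_preserving M T"
    and comm: "\<And>x. x \<in> space M \<Longrightarrow> S (T x) = T (S x)" and B: "simple_function M B"
  shows "partition_entropy M (itinerary S (itinerary T B m) n) \<le> real m * partition_entropy M (itinerary S B n)"
proof (induction m)
  case 0
  have "itinerary S (itinerary T B 0) n = (\<lambda>x. replicate n [])"
    by (auto simp: itinerary_0 itinerary_def map_replicate_const)
  then show ?case by (simp add: partition_entropy_const)
next
  case (Suc m)
  note s = simple_function_itinerary[OF S simple_function_itinerary[OF T B]]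
  have "partition_entropy M (itinerary S (itinerary T B (Suc m)) n)
      \<le> partition_entropy M (itinerary S B n) + partition_entropy M (\<lambda>x. itinerary S (itinerary T B m) n (T x))"
  proof (intro partition_entropy_subadditive s simple_function_itinerary[OF S B]
      simple_function_compose_measure_preserving[OF T])
    fix x y assume x: "x \<in> space M" and y: "y \<in> space M"
      and "itinerary S B n x = itinerary S B n y"
      and "itinerary S (itinerary T B m) n (T x) = itinerary S (itinerary T B m) n (T y)"
    then show "itinerary S (itinerary T B (Suc m)) n x = itinerary S (itinerary T B (Suc m)) n y"
      using S commute_funpow(2)[of S T x] commute_funpow(2)[of S T y] comm
      unfolding itinerary_eq_iff[of S] itinerary_Suc by (simp add: measure_preserving_def)
  qed
  also have "partition_entropy M (\<lambda>x. itinerary S (itinerary T B m) n (T x))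
      = partition_entropy M (itinerary S (itinerary T B m) n)"
    by (rule partition_entropy_compose[OF T s])
  finally show ?case using Suc by (simp add: algebra_simps)
qed

text \<open>The result on conditioning on the future is applied to the power S^m, whose future is
  the S-future from time m on, with m-blocks of A as generator and the m-step T-join of B as
  partition of zero entropy. That T-join is thus asymptotically determined by the symbols of A from
  time m on.\<close>

lemma zero_entropy_conditional_on_far_future:
  assumes S: "measure_preserving M S" and T: "measure_preserving M T"
    and comm: "\<And>x. x \<in> space M \<Longrightarrow> S (T x) = T (S x)"
    and A: "simple_function M A" and B: "simple_function M B"
    and gen: "\<And>E. E \<in> events \<Longrightarrow> (\<lambda>n. partition_entropy M (\<lambda>x. (x \<in> E, itinerary S A n x))
      - partition_entropy M (itinerary S A n)) \<longlonglongrightarrow> 0"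
    and zero: "dynamical_entropy M S B = 0" and m: "0 < m"
  shows "(\<lambda>n. partition_entropy M (\<lambda>x. (itinerary T B m x, itinerary S A (m * n) ((S ^^ m) x)))
      - partition_entropy M (itinerary S A (m * n))) \<longlonglongrightarrow> 0"
proof -
  define R where "R = S ^^ m"
  define A' where "A' = itinerary S A m"
  define B' where "B' = itinerary T B m"
  have R: "measure_preserving M R" unfolding R_def by (rule measure_preserving_funpow[OF S])
  have A': "simple_function M A'" unfolding A'_def by (rule simple_function_itinerary[OF S A])
  have B': "simple_function M B'" unfolding B'_def by (rule simple_function_itinerary[OF T B])
  note sR = simple_function_itinerary[OF R] and sS = simple_function_itinerary[OF S]
  have iff: "itinerary R A' n x = itinerary R A' n y \<longleftrightarrow> itinerary S A (m * n) x = itinerary S A (m * n) y" for n x y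
    unfolding R_def A'_def by (rule itinerary_funpow_eq_iff[OF m])
  have H: "partition_entropy M (itinerary R A' n) = partition_entropy M (itinerary S A (m * n))" for n
    by (intro partition_entropy_eqI sR sS A A') (simp add: iff)
  have mono: "strict_mono (\<lambda>n. m * n)" using m by (auto simp: strict_mono_def)
  have "(\<lambda>n. partition_entropy M (\<lambda>x. (B' x, itinerary R A' n (R x)))
      - partition_entropy M (itinerary R A' n)) \<longlonglongrightarrow> 0"
  proof (rule zero_entropy_conditional_on_future[OF R A' B'])
    have "partition_entropy M (itinerary R B' n) \<le> real m * partition_entropy M (itinerary S B (m * n))" for n
    proof -
      have "partition_entropy M (itinerary R B' n) \<le> partition_entropy M (itinerary S B' (m * n))"
        using m by (intro partition_entropy_mono sR sS B') (auto simp: R_def itinerary_eq_iff funpow_mult)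
      also have "\<dots> \<le> real m * partition_entropy M (itinerary S B (m * n))"
        unfolding B'_def by (rule entropy_itinerary_of_itinerary_le[OF S T comm B])
      finally show ?thesis .
    qed
    \<comment> \<open>One factor m counts the layers of the T-join, the other compensates for
      dividing by m * n instead of n.\<close>
    then have le: "partition_entropy M (itinerary R B' n) / real n
        \<le> real m * real m * (partition_entropy M (itinerary S B (m * n)) / real (m * n))" for n
      using m by (cases "n = 0") (simp_all add: divide_right_mono)
    have "(\<lambda>n. partition_entropy M (itinerary S B n) / real n) \<longlonglongrightarrow> 0"
      using itinerary_entropy_increment(2)[OF S B] zero by simp
    from LIMSEQ_subseq_LIMSEQ[OF this mono]
    have "(\<lambda>n. real m * real m * (partition_entropy M (itinerary S B (m * n)) / real (m * n))) \<longlonglongrightarrow> real m * real m * 0"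
      by (intro tendsto_mult tendsto_const) (simp add: comp_def)
    then have upper: "(\<lambda>n. real m * real m * (partition_entropy M (itinerary S B (m * n)) / real (m * n))) \<longlonglongrightarrow> 0"
      by simp
    show "(\<lambda>n. partition_entropy M (itinerary R B' n) / real n) \<longlonglongrightarrow> 0"
      using le partition_entropy_nonneg[OF sR[OF B']]
      by (intro tendsto_sandwich[OF _ _ tendsto_const upper] always_eventually allI) auto
    have "(\<lambda>n. partition_entropy M (\<lambda>x. (B' x, itinerary S A n x)) - partition_entropy M (itinerary S A n)) \<longlonglongrightarrow> 0"
      by (rule conditional_entropy_tendsto_0_simple[OF sS[OF A] gen B'])
    from LIMSEQ_subseq_LIMSEQ[OF this mono]
    have "(\<lambda>n. partition_entropy M (\<lambda>x. (B' x, itinerary S A (m * n) x)) - partition_entropy M (itinerary S A (m * n))) \<longlonglongrightarrow> 0"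
      by (simp add: comp_def)
    moreover have "partition_entropy M (\<lambda>x. (B' x, itinerary R A' n x)) = partition_entropy M (\<lambda>x. (B' x, itinerary S A (m * n) x))" for n
      by (intro partition_entropy_eqI simple_function_Pair sR sS A A' B') (simp add: iff)
    ultimately show "(\<lambda>n. partition_entropy M (\<lambda>x. (B' x, itinerary R A' n x)) - partition_entropy M (itinerary R A' n)) \<longlonglongrightarrow> 0"
      by (simp add: H)
  qed
  moreover have "partition_entropy M (\<lambda>x. (B' x, itinerary R A' n (R x)))
      = partition_entropy M (\<lambda>x. (B' x, itinerary S A (m * n) (R x)))" for n
    by (intro partition_entropy_eqI simple_function_Pair B'
        simple_function_compose_measure_preserving[OF R sR[OF A']]
        simple_function_compose_measure_preserving[OF R sS[OF A]]) (simp add: iff)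
  ultimately have "(\<lambda>n. partition_entropy M (\<lambda>x. (B' x, itinerary S A (m * n) (R x)))
      - partition_entropy M (itinerary S A (m * n))) \<longlonglongrightarrow> 0"
    by (simp add: H)
  then show ?thesis by (simp add: R_def B'_def)
qed

text \<open>For every i < m, the A-window of length m + k contains the window of length k starting
  at i. So each of the m symbols of B adds at most H(B | A_k).\<close>

lemma entropy_joint_itinerary_le:
  assumes T: "measure_preserving M T" and A: "simple_function M A" and B: "simple_function M B"
  shows "partition_entropy M (\<lambda>x. (itinerary T A (m + k) x, itinerary T B m x))
    \<le> partition_entropy M (itinerary T A (m + k))
      + real m * (partition_entropy M (\<lambda>x. (B x, itinerary T A k x)) - partition_entropy M (itinerary T A k))"
proof (induction m)
  case 0
  have "partition_entropy M (\<lambda>x. (itinerary T A k x, [] :: 'c list)) \<le> partition_entropy M (itinerary T A k)"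
    by (intro partition_entropy_mono simple_function_Pair simple_function_itinerary[OF T A]) auto
  then show ?case by (simp add: itinerary_0)
next
  case (Suc m)
  note simple = simple_function_Pair A B simple_function_itinerary[OF T A] simple_function_itinerary[OF T B]
    simple_function_itinerary_shift[OF T A] simple_function_itinerary_shift[OF T B]
  define X where "X = itinerary T A (Suc (m + k))"
  have X: "simple_function M X" unfolding X_def by (rule simple_function_itinerary[OF T A])
  have "partition_entropy M (\<lambda>x. (X x, itinerary T B (Suc m) x)) + partition_entropy M X
      \<le> partition_entropy M (\<lambda>x. (B x, X x)) + partition_entropy M (\<lambda>x. (X x, itinerary T B m (T x)))"
    by (intro partition_entropy_submodular simple X) (auto simp: itinerary_Suc)
  moreover have "partition_entropy M (\<lambda>x. (B x, X x)) + partition_entropy M (itinerary T A k)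
      \<le> partition_entropy M (\<lambda>x. (B x, itinerary T A k x)) + partition_entropy M X"
    by (intro partition_entropy_submodular simple X) (auto simp: X_def itinerary_eq_iff)
  moreover have "partition_entropy M (\<lambda>x. (X x, itinerary T B m (T x))) + partition_entropy M (\<lambda>x. itinerary T A (m + k) (T x))
      \<le> partition_entropy M X + partition_entropy M (\<lambda>x. (itinerary T A (m + k) (T x), itinerary T B m (T x)))"
    by (intro partition_entropy_submodular simple X) (auto simp: X_def itinerary_Suc)
  moreover have "partition_entropy M (\<lambda>x. (itinerary T A (m + k) (T x), itinerary T B m (T x)))
      = partition_entropy M (\<lambda>x. (itinerary T A (m + k) x, itinerary T B m x))"
    by (rule partition_entropy_compose[OF T]) (intro simple)
  ultimately show ?case
    using Suc partition_entropy_itinerary_shift[OF T A, of "m + k"]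
    by (simp add: X_def algebra_simps)
qed

text \<open>The joint entropy of the m-step T-itineraries A_m and B_m is estimated from both sides.
  It is at least m h + H(B_m), where h is the entropy of A, which is the same under both maps. It is
  at most H(A_m) + H(A_k) + m e_k with e_k tending to 0, as A generates. So H(B_m) grows
  sublinearly.\<close>

lemma dynamical_entropy_eq_0_commuting:
  assumes S: "measure_preserving M S" and T: "measure_preserving M T"
    and comm: "\<And>x. x \<in> space M \<Longrightarrow> S (T x) = T (S x)"
    and A: "simple_function M A" and B: "simple_function M B"
    and same: "\<And>n x y. x \<in> space M \<Longrightarrow> y \<in> space M \<Longrightarrow>
      itinerary S A n x = itinerary S A n y \<longleftrightarrow> itinerary T A n x = itinerary T A n y"
    and gen: "\<And>E. E \<in> events \<Longrightarrow> (\<lambda>n. partition_entropy M (\<lambda>x. (x \<in> E, itinerary S A n x))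
      - partition_entropy M (itinerary S A n)) \<longlonglongrightarrow> 0"
    and zero: "dynamical_entropy M S B = 0"
  shows "dynamical_entropy M T B = 0"
proof -
  note sS = simple_function_itinerary[OF S] and sT = simple_function_itinerary[OF T]
  have H: "partition_entropy M (itinerary S A n) = partition_entropy M (itinerary T A n)" for n
    by (intro partition_entropy_eqI sS sT A same)
  define h where "h = dynamical_entropy M S A"
  have hT: "h = dynamical_entropy M T A"
    unfolding h_def dynamical_entropy_def H ..
  \<comment> \<open>Up to an entropy \<open>d n\<close>, the T-itinerary of B is determined by the
    A-symbols from S-time m on. Given those, the first m symbols of A still have entropy at least m
    h, and conditioning on the T-itinerary of B alone can only leave more.\<close>
  have lower: "real m * h + partition_entropy M (itinerary T B m)
      \<le> partition_entropy M (\<lambda>x. (itinerary T A m x, itinerary T B m x))" if m: "0 < m" for m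
  proof -
    let ?c = "partition_entropy M (\<lambda>x. (itinerary T A m x, itinerary T B m x))"
    define d where "d n = partition_entropy M (\<lambda>x. (itinerary T B m x, itinerary S A (m * n) ((S ^^ m) x)))
      - partition_entropy M (itinerary S A (m * n))" for n
    have d: "d \<longlonglongrightarrow> 0"
      unfolding d_def[abs_def] by (rule zero_entropy_conditional_on_far_future[OF S T comm A B gen zero m])
    have "real m * h + partition_entropy M (itinerary T B m) \<le> ?c + d n" for n
    proof -
      note sn = simple_function_compose_measure_preserving[OF measure_preserving_funpow[OF S] sS[OF A], of "m * n" m]
      have "partition_entropy M (itinerary S A (m + m * n))
          \<le> partition_entropy M (\<lambda>x. (itinerary T A m x, itinerary T B m x, itinerary S A (m * n) ((S ^^ m) x)))"
      proof (intro partition_entropy_mono simple_function_Pair sS sT A B sn)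
        fix x y assume xy: "x \<in> space M" "y \<in> space M"
          and "(itinerary T A m x, itinerary T B m x, itinerary S A (m * n) ((S ^^ m) x))
            = (itinerary T A m y, itinerary T B m y, itinerary S A (m * n) ((S ^^ m) y))"
        then have 1: "\<forall>i<m. A ((S ^^ i) x) = A ((S ^^ i) y)"
          and 2: "\<forall>i<m * n. A ((S ^^ (i + m)) x) = A ((S ^^ (i + m)) y)"
          using same[OF xy, of m] by (auto simp: itinerary_eq_iff funpow_add)
        have "A ((S ^^ i) x) = A ((S ^^ i) y)" if "i < m + m * n" for i
          using 1 2[rule_format, of "i - m"] that by (cases "i < m") auto
        then show "itinerary S A (m + m * n) x = itinerary S A (m + m * n) y"
          by (simp add: itinerary_eq_iff)
      qed
      moreover have "partition_entropy M (\<lambda>x. (itinerary T A m x, itinerary T B m x, itinerary S A (m * n) ((S ^^ m) x)))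
          + partition_entropy M (itinerary T B m)
        \<le> ?c + partition_entropy M (\<lambda>x. (itinerary T B m x, itinerary S A (m * n) ((S ^^ m) x)))"
        by (intro partition_entropy_submodular simple_function_Pair sS sT A B sn) auto
      moreover have "real m * h \<le> partition_entropy M (itinerary S A (m + m * n)) - partition_entropy M (itinerary S A (m * n))"
        unfolding h_def by (rule dynamical_entropy_mult_le[OF S A])
      ultimately show ?thesis by (simp add: d_def)
    qed
    moreover have "(\<lambda>n. ?c + d n) \<longlonglongrightarrow> ?c + 0"
      by (intro tendsto_add tendsto_const d)
    ultimately show ?thesis by (intro LIMSEQ_le_const[of "\<lambda>n. ?c + d n"]) auto
  qed
  define e where "e k = partition_entropy M (\<lambda>x. (B x, itinerary T A k x)) - partition_entropy M (itinerary T A k)" for k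
  have "(\<lambda>k. partition_entropy M (\<lambda>x. (B x, itinerary S A k x)) - partition_entropy M (itinerary S A k)) \<longlonglongrightarrow> 0"
    by (rule conditional_entropy_tendsto_0_simple[OF sS[OF A] gen B])
  moreover have "partition_entropy M (\<lambda>x. (B x, itinerary S A k x)) = partition_entropy M (\<lambda>x. (B x, itinerary T A k x))" for k
    by (intro partition_entropy_eqI simple_function_Pair sS sT A B) (simp add: same)
  ultimately have e: "e \<longlonglongrightarrow> 0" by (simp add: H e_def[abs_def])
  \<comment> \<open>The k extra steps of the A-window cost a constant, which disappears on division
    by m. What remains per step is \<open>e k\<close>.\<close>
  have le: "dynamical_entropy M T B \<le> e k" for k
  proof -
    have "partition_entropy M (itinerary T B m) / real m
        \<le> partition_entropy M (itinerary T A m) / real m + partition_entropy M (itinerary T A k) / real m + e k - h"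
      if m: "0 < m" for m
    proof -
      note s = simple_function_compose_measure_preserving[OF measure_preserving_funpow[OF T] sT[OF A], of k m]
      have "partition_entropy M (\<lambda>x. (itinerary T A m x, itinerary T B m x))
          \<le> partition_entropy M (\<lambda>x. (itinerary T A (m + k) x, itinerary T B m x))"
        by (intro partition_entropy_mono simple_function_Pair sT A B) (auto simp: itinerary_eq_iff)
      also have "\<dots> \<le> partition_entropy M (itinerary T A (m + k)) + real m * e k"
        unfolding e_def by (rule entropy_joint_itinerary_le[OF T A B])
      also have "partition_entropy M (itinerary T A (m + k))
          \<le> partition_entropy M (itinerary T A m) + partition_entropy M (\<lambda>x. itinerary T A k ((T ^^ m) x))"
      proof (intro partition_entropy_subadditive sT A s)
        fix x y assume "itinerary T A m x = itinerary T A m y"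
          "itinerary T A k ((T ^^ m) x) = itinerary T A k ((T ^^ m) y)"
        then have 1: "\<forall>i<m. A ((T ^^ i) x) = A ((T ^^ i) y)"
          and 2: "\<forall>i<k. A ((T ^^ (i + m)) x) = A ((T ^^ (i + m)) y)"
          by (auto simp: itinerary_eq_iff funpow_add)
        have "A ((T ^^ i) x) = A ((T ^^ i) y)" if "i < m + k" for i
          using 1 2[rule_format, of "i - m"] that by (cases "i < m") auto
        then show "itinerary T A (m + k) x = itinerary T A (m + k) y"
          by (simp add: itinerary_eq_iff)
      qed
      also have "partition_entropy M (\<lambda>x. itinerary T A k ((T ^^ m) x)) = partition_entropy M (itinerary T A k)"
        by (rule partition_entropy_compose[OF measure_preserving_funpow[OF T] sT[OF A]])
      finally have "partition_entropy M (itinerary T B m)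
          \<le> partition_entropy M (itinerary T A m) + partition_entropy M (itinerary T A k) + real m * (e k - h)"
        using lower[OF m] by (simp add: algebra_simps)
      then have "partition_entropy M (itinerary T B m) / real m
          \<le> (partition_entropy M (itinerary T A m) + partition_entropy M (itinerary T A k) + real m * (e k - h)) / real m"
        by (rule divide_right_mono) simp
      then show ?thesis using m by (simp add: add_divide_distrib)
    qed
    moreover have "(\<lambda>m. partition_entropy M (itinerary T A m) / real m + partition_entropy M (itinerary T A k) / real m + e k - h)
        \<longlonglongrightarrow> h + 0 + e k - h"
      unfolding hT by (intro tendsto_intros itinerary_entropy_increment(2)[OF T A]
          real_tendsto_divide_at_top filterlim_real_sequentially)
    ultimately have "dynamical_entropy M T B \<le> h + 0 + e k - h"
      by (intro LIMSEQ_le[OF itinerary_entropy_increment(2)[OF T B]]) (auto intro: exI[of _ 1])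
    then show ?thesis by simp
  qed
  have "dynamical_entropy M T B \<le> 0"
    using le by (intro LIMSEQ_le_const[OF e]) auto
  moreover have "0 \<le> dynamical_entropy M T B"
    using partition_entropy_nonneg[OF sT[OF B]]
    by (intro LIMSEQ_le_const[OF itinerary_entropy_increment(2)[OF T B]]) auto
  ultimately show ?thesis by simp
qed

end

subsection \<open>The group multiplication cellular automaton\<close>

text \<open>Almost surely all symbols of an itinerary equal the first one, so the entropies of the
  itineraries stay below H(B) and vanish after division by n.\<close>

lemma (in prob_space) dynamical_entropy_eq_0_invariant:
  assumes T: "measure_preserving M T" and B: "simple_function M B" and inv: "AE x in M. B (T x) = B x"
  shows "dynamical_entropy M T B = 0"
proof -
  have meas: "T \<in> M \<rightarrow>\<^sub>M M" and D: "distr M M T = M" using T by (auto simp: measure_preserving_def)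
  note sT = simple_function_itinerary[OF T B]
  have sR: "simple_function M (\<lambda>x. replicate n (B x))" for n
    by (rule simple_function_compose1[OF B])
  have "AE x in M. itinerary T B n x = replicate n (B x)" for n
  proof (induction n)
    case 0
    show ?case by (simp add: itinerary_0)
  next
    case (Suc n)
    have "AE x in M. itinerary T B n (T x) = replicate n (B (T x))"
      using Suc by (intro AE_distrD[OF meas]) (simp only: D)
    then show ?case using inv by eventually_elim (simp add: itinerary_Suc)
  qed
  then have "partition_entropy M (itinerary T B n) = partition_entropy M (\<lambda>x. replicate n (B x))" for n
    by (rule partition_entropy_cong_AE[OF sT sR])
  moreover have "partition_entropy M (\<lambda>x. replicate n (B x)) \<le> partition_entropy M B" for n
    by (rule partition_entropy_mono[OF B sR]) simp
  ultimately have le: "partition_entropy M (itinerary T B n) / real n \<le> partition_entropy M B / real n" for n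
    by (intro divide_right_mono) auto
  have upper: "(\<lambda>n. partition_entropy M B / real n) \<longlonglongrightarrow> 0"
    by (rule real_tendsto_divide_at_top[OF tendsto_const filterlim_real_sequentially])
  have "(\<lambda>n. partition_entropy M (itinerary T B n) / real n) \<longlonglongrightarrow> 0"
    using le partition_entropy_nonneg[OF sT]
    by (intro tendsto_sandwich[OF _ _ tendsto_const upper] always_eventually allI) auto
  with itinerary_entropy_increment(2)[OF T B] show ?thesis by (rule LIMSEQ_unique)
qed

section \<open>Itineraries of the shift and of the automaton\<close>

lemma shift_funpow: "(shift ^^ n) x i = x (i + n)"
  by (induction n arbitrary: i) (auto simp: shift_def)

lemma shift_group_ca: "shift (group_ca G x) = group_ca G (shift x)"
  by (simp add: shift_def group_ca_def)

locale group_ca_measure = group G + prob_space \<mu>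
  for G :: "('a, 'b) monoid_scheme" (structure) and \<mu> :: "(nat \<Rightarrow> 'a) measure" +
  assumes finite_carrier: "finite (carrier G)"
    and sets_eq: "sets \<mu> = sets (config_space G)"
    and shift: "measure_preserving \<mu> shift"
    and ca: "measure_preserving \<mu> (group_ca G)"
begin

lemma mem_space_iff: "x \<in> space \<mu> \<longleftrightarrow> (\<forall>i. x i \<in> carrier G)"
  unfolding sets_eq_imp_space_eq[OF sets_eq] by (auto simp: config_space_def space_PiM PiE_iff)

lemma coordinate_measurable: "(\<lambda>x. x i) \<in> \<mu> \<rightarrow>\<^sub>M count_space (carrier G)"
  unfolding measurable_cong_sets[OF sets_eq refl] config_space_def
  by (rule measurable_component_singleton) simp

lemma simple_function_coordinate: "simple_function \<mu> (\<lambda>x. x i)"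
  unfolding simple_function_def
proof (intro conjI ballI)
  have "(\<lambda>x. x i) ` space \<mu> \<subseteq> carrier G" by (auto simp: mem_space_iff)
  then show "finite ((\<lambda>x. x i) ` space \<mu>)" using finite_carrier by (rule finite_subset)
  fix v assume "v \<in> (\<lambda>x. x i) ` space \<mu>"
  then have "v \<in> carrier G" by (auto simp: mem_space_iff)
  then show "(\<lambda>x. x i) -` {v} \<inter> space \<mu> \<in> sets \<mu>"
    using measurable_sets[OF coordinate_measurable, of "{v}" i] by simp
qed

text \<open>As the carrier is finite, events fixing a single symbol generate the product
  sigma-algebra. This is the shape in which the entropy results expect a generator.\<close>

lemma sets_eq_coordinate_events:
  "sets \<mu> = sigma_sets (space \<mu>) {{x \<in> space \<mu>. (shift ^^ i) x 0 = v} | i v. True}"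
  (is "_ = sigma_sets _ ?E")
proof
  have "{x \<in> space \<mu>. (shift ^^ i) x 0 = v} \<in> sets \<mu>" for i v
    using simple_function_Collect_eq[OF simple_function_coordinate, of i v] by (simp add: shift_funpow)
  then show "sigma_sets (space \<mu>) ?E \<subseteq> sets \<mu>"
    by (intro sets.sigma_sets_subset) auto
  have "{x \<in> space \<mu>. x i \<in> V} \<in> sigma_sets (space \<mu>) ?E" if V: "V \<subseteq> carrier G" for i V
  proof -
    interpret E: sigma_algebra "space \<mu>" "sigma_sets (space \<mu>) ?E"
      by (rule sigma_algebra_sigma_sets) auto
    have "{x \<in> space \<mu>. x i \<in> V} = (\<Union>v\<in>V. {x \<in> space \<mu>. (shift ^^ i) x 0 = v})"
      by (auto simp: shift_funpow)
    also have "\<dots> \<in> sigma_sets (space \<mu>) ?E"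
      using finite_subset[OF V finite_carrier] by (intro E.finite_UN) auto
    finally show ?thesis .
  qed
  moreover have "sets \<mu> = sigma_sets (space \<mu>) {{x \<in> space \<mu>. x i \<in> V} | i V. V \<subseteq> carrier G}"
    unfolding sets_eq_imp_space_eq[OF sets_eq] sets_eq config_space_def
    by (simp add: sets_PiM_single space_PiM)
  ultimately show "sets \<mu> \<subseteq> sigma_sets (space \<mu>) ?E"
    by (simp only:) (intro sigma_sets_mono, auto)
qed

lemma ca_funpow_mem: "x \<in> space \<mu> \<Longrightarrow> (group_ca G ^^ j) x i \<in> carrier G"
  using measure_preserving_space[OF measure_preserving_funpow[OF ca], of x j] by (simp add: mem_space_iff)

lemma ca_funpow_Suc: "(group_ca G ^^ Suc j) x i = (group_ca G ^^ j) x i \<otimes> (group_ca G ^^ j) x (Suc i)"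
  by (simp add: group_ca_def)

lemma ca_funpow_eq:
  assumes "\<And>i. i < n \<Longrightarrow> x i = y i" and "i + j < n"
  shows "(group_ca G ^^ j) x i = (group_ca G ^^ j) y i"
  using assms(2) by (induction j arbitrary: i) (simp_all add: assms(1) ca_funpow_Suc del: funpow.simps(2))

text \<open>The space-time triangle is filled column by column: the entry of column i+1 in row j
  follows by left cancellation from the entries of column i in rows j and j+1. Each further column
  costs one row, whence the bound i + j < n.\<close>

lemma ca_funpow_eqD:
  assumes x: "x \<in> space \<mu>" and y: "y \<in> space \<mu>"
    and eq: "\<And>j. j < n \<Longrightarrow> (group_ca G ^^ j) x 0 = (group_ca G ^^ j) y 0" and "i + j < n"
  shows "(group_ca G ^^ j) x i = (group_ca G ^^ j) y i"
  using assms(4)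
proof (induction i arbitrary: j)
  case (Suc i)
  have "(group_ca G ^^ j) x i \<otimes> (group_ca G ^^ j) x (Suc i) = (group_ca G ^^ Suc j) y i"
    using Suc.IH[of "Suc j"] Suc.prems by (simp only: flip: ca_funpow_Suc)
  also have "\<dots> = (group_ca G ^^ j) x i \<otimes> (group_ca G ^^ j) y (Suc i)"
    using Suc.IH[of j] Suc.prems by (simp only: ca_funpow_Suc)
  finally show ?case
    using x y by (simp add: ca_funpow_mem)
qed (use eq in simp)

lemma itinerary_shift_iff_ca:
  assumes "x \<in> space \<mu>" "y \<in> space \<mu>"
  shows "itinerary shift (\<lambda>x. x 0) n x = itinerary shift (\<lambda>x. x 0) n y
    \<longleftrightarrow> itinerary (group_ca G) (\<lambda>x. x 0) n x = itinerary (group_ca G) (\<lambda>x. x 0) n y"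
proof -
  have "(group_ca G ^^ j) x 0 = (group_ca G ^^ j) y 0" if "\<And>i. i < n \<Longrightarrow> x i = y i" "j < n" for j
    using ca_funpow_eq[of n x y 0 j] that by auto
  moreover have "x i = y i" if "\<And>j. j < n \<Longrightarrow> (group_ca G ^^ j) x 0 = (group_ca G ^^ j) y 0" "i < n" for i
    using ca_funpow_eqD[OF assms, of n i 0] that by auto
  ultimately show ?thesis unfolding itinerary_eq_iff shift_funpow by auto
qed

lemma coordinate_generates_shift:
  assumes "A \<in> sets \<mu>"
  shows "(\<lambda>n. partition_entropy \<mu> (\<lambda>x. (x \<in> A, itinerary shift (\<lambda>x. x 0) n x))
    - partition_entropy \<mu> (itinerary shift (\<lambda>x. x 0) n)) \<longlonglongrightarrow> 0"
  by (rule conditional_entropy_tendsto_0_generator[OF shift simple_function_coordinate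
        sets_eq_coordinate_events assms])

lemma coordinate_generates_ca:
  assumes A: "A \<in> sets \<mu>"
  shows "(\<lambda>n. partition_entropy \<mu> (\<lambda>x. (x \<in> A, itinerary (group_ca G) (\<lambda>x. x 0) n x))
    - partition_entropy \<mu> (itinerary (group_ca G) (\<lambda>x. x 0) n)) \<longlonglongrightarrow> 0"
proof -
  note s = simple_function_itinerary[OF shift simple_function_coordinate]
    simple_function_itinerary[OF ca simple_function_coordinate]
  have "partition_entropy \<mu> (itinerary shift (\<lambda>x. x 0) n) = partition_entropy \<mu> (itinerary (group_ca G) (\<lambda>x. x 0) n)" for n
    by (intro partition_entropy_eqI s) (rule itinerary_shift_iff_ca)
  moreover have "partition_entropy \<mu> (\<lambda>x. (x \<in> A, itinerary shift (\<lambda>x. x 0) n x))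
      = partition_entropy \<mu> (\<lambda>x. (x \<in> A, itinerary (group_ca G) (\<lambda>x. x 0) n x))" for n
    by (intro partition_entropy_eqI simple_function_Pair simple_function_mem A s) (simp add: itinerary_shift_iff_ca)
  ultimately show ?thesis using coordinate_generates_shift[OF A] by simp
qed

text \<open>The criterion for commuting maps applies in both directions because the symbol at the
  origin generates under either map.\<close>

lemma zero_entropy_shift_iff_ca:
  assumes B: "simple_function \<mu> B"
  shows "dynamical_entropy \<mu> shift B = 0 \<longleftrightarrow> dynamical_entropy \<mu> (group_ca G) B = 0"
proof
  assume "dynamical_entropy \<mu> shift B = 0"
  then show "dynamical_entropy \<mu> (group_ca G) B = 0"
    by (rule dynamical_entropy_eq_0_commuting[OF shift ca _ simple_function_coordinate B
          itinerary_shift_iff_ca coordinate_generates_shift, rotated -1]) (auto simp: shift_group_ca)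
next
  assume "dynamical_entropy \<mu> (group_ca G) B = 0"
  then show "dynamical_entropy \<mu> shift B = 0"
    by (rule dynamical_entropy_eq_0_commuting[OF ca shift _ simple_function_coordinate B
          itinerary_shift_iff_ca[symmetric] coordinate_generates_ca, rotated -1]) (auto simp: shift_group_ca)
qed

lemma pinsker_algebra_shift_eq_ca: "pinsker_algebra \<mu> shift = pinsker_algebra \<mu> (group_ca G)"
proof -
  have "{A \<in> sets \<mu>. dynamical_entropy \<mu> shift (\<lambda>x. x \<in> A) = 0}
      = {A \<in> sets \<mu>. dynamical_entropy \<mu> (group_ca G) (\<lambda>x. x \<in> A) = 0}"
    using zero_entropy_shift_iff_ca[OF simple_function_mem] by blast
  then show ?thesis by (simp add: pinsker_algebra_def)
qed

section \<open>The sigma-algebra of the future and invariant events\<close>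

abbreviation future :: "(nat \<Rightarrow> 'a) measure" where
  "future \<equiv> vimage_algebra (space \<mu>) shift \<mu>"

lemma shift_measurable: "shift \<in> \<mu> \<rightarrow>\<^sub>M \<mu>" and ca_measurable: "group_ca G \<in> \<mu> \<rightarrow>\<^sub>M \<mu>"
  using shift ca unfolding measure_preserving_def by blast+

lemma shift_space: "shift \<in> space \<mu> \<rightarrow> space \<mu>"
  using measure_preserving_space[OF shift] by blast

lemma sets_future: "sets future = {shift -` A \<inter> space \<mu> | A. A \<in> sets \<mu>}"
  by (rule sets_vimage_algebra2[OF shift_space])

lemma subalgebra_future: "subalgebra \<mu> future"
  unfolding subalgebra_def sets_future space_vimage_algebra
  using measurable_sets[OF shift_measurable] by blast

lemma shift_measurable_future: "shift \<in> future \<rightarrow>\<^sub>M \<mu>"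
  by (rule measurable_vimage_algebra1[OF shift_space])

lemma ca_measurable_future: "group_ca G \<in> future \<rightarrow>\<^sub>M future"
proof (rule measurableI)
  fix x assume "x \<in> space future"
  then show "group_ca G x \<in> space future" by (simp add: measure_preserving_space[OF ca])
next
  fix E assume "E \<in> sets future"
  then obtain A where A: "A \<in> sets \<mu>" "E = shift -` A \<inter> space \<mu>" by (auto simp: sets_future)
  have "group_ca G -` E \<inter> space future = shift -` (group_ca G -` A \<inter> space \<mu>) \<inter> space \<mu>"
    using measure_preserving_space[OF ca] measure_preserving_space[OF shift]
    by (auto simp: A shift_group_ca)
  moreover have "group_ca G -` A \<inter> space \<mu> \<in> sets \<mu>"
    using measurable_sets[OF ca_measurable A(1)] .
  ultimately show "group_ca G -` E \<inter> space future \<in> sets future"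
    unfolding sets_future by blast
qed

text \<open>An invariant event has zero entropy under the automaton, hence under the shift, and is
  then determined by the future of the generator. The first conclusion gives membership in the
  Pinsker algebra, the second is the source of the coset structure.\<close>

lemma AE_future_measurable_of_ca_invariant:
  assumes A: "A \<in> sets \<mu>" and inv: "AE x in \<mu>. group_ca G x \<in> A \<longleftrightarrow> x \<in> A"
  shows "dynamical_entropy \<mu> (group_ca G) (\<lambda>x. x \<in> A) = 0"
    and "\<exists>A'\<in>sets future. AE x in \<mu>. x \<in> A \<longleftrightarrow> x \<in> A'"
proof -
  have sA: "simple_function \<mu> (\<lambda>x. x \<in> A)" by (rule simple_function_mem[OF A])
  show zero: "dynamical_entropy \<mu> (group_ca G) (\<lambda>x. x \<in> A) = 0"
    by (rule dynamical_entropy_eq_0_invariant[OF ca sA inv])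
  then have "dynamical_entropy \<mu> shift (\<lambda>x. x \<in> A) = 0"
    by (simp add: zero_entropy_shift_iff_ca[OF sA])
  then have "(\<lambda>n. partition_entropy \<mu> (itinerary shift (\<lambda>x. x \<in> A) n) / real n) \<longlonglongrightarrow> 0"
    using itinerary_entropy_increment(2)[OF shift sA] by simp
  note lim = zero_entropy_conditional_on_future[OF shift simple_function_coordinate sA this coordinate_generates_shift[OF A]]
  note s = simple_function_itinerary[OF shift simple_function_coordinate]
  show "\<exists>A'\<in>sets future. AE x in \<mu>. x \<in> A \<longleftrightarrow> x \<in> A'"
  proof (rule AE_measurable_of_conditional_entropy_tendsto_0[OF subalgebra_future _ A])
    show "simple_function future (\<lambda>x. itinerary shift (\<lambda>x. x 0) n (shift x))" for n
      by (rule simple_function_comp[OF shift_measurable_future s])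
    show "(\<lambda>n. partition_entropy \<mu> (\<lambda>x. (x \<in> A, itinerary shift (\<lambda>x. x 0) n (shift x)))
        - partition_entropy \<mu> (\<lambda>x. itinerary shift (\<lambda>x. x 0) n (shift x))) \<longlonglongrightarrow> 0"
      using lim by (simp add: partition_entropy_compose[OF shift s])
  qed
qed

end

subsection \<open>Conditional distribution of the symbol at the origin\<close>

text \<open>Comparing s = a s0 with s0 for g = a^-1 gives p(a^-1 s0) = p(s0) > 0, hence inverses.
  Comparing s = b s0 with s0 for g = a gives p(a b s0) = p(a s0) > 0, hence products.\<close>

lemma (in group) coset_of_quasi_invariant:
  fixes p :: "'a \<Rightarrow> real"
  assumes s0: "s0 \<in> carrier G" "0 < p s0"
    and const: "\<And>g s s'. g \<in> carrier G \<Longrightarrow> s \<in> carrier G \<Longrightarrow> s' \<in> carrier G \<Longrightarrow>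
      0 < p s \<Longrightarrow> 0 < p s' \<Longrightarrow> p (g \<otimes> s) = p (g \<otimes> s')"
  defines "H \<equiv> {h \<in> carrier G. 0 < p (h \<otimes> s0)}"
  shows "subgroup H G" and "H #> s0 = {g \<in> carrier G. 0 < p g}"
proof -
  show "subgroup H G"
  proof (rule subgroupI)
    show "H \<noteq> {}" using s0 by (auto simp: H_def intro!: exI[of _ \<one>])
  next
    fix a assume a: "a \<in> H"
    then have "p (inv a \<otimes> (a \<otimes> s0)) = p (inv a \<otimes> s0)"
      using s0 by (intro const) (auto simp: H_def)
    then show "inv a \<in> H"
      using a s0 by (auto simp: H_def simp flip: m_assoc)
  next
    fix a b assume "a \<in> H" "b \<in> H"
    moreover from this have "p (a \<otimes> (b \<otimes> s0)) = p (a \<otimes> s0)"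
      using s0 by (intro const) (auto simp: H_def)
    ultimately show "a \<otimes> b \<in> H" using s0 by (auto simp: H_def m_assoc)
  qed (auto simp: H_def)
  show "H #> s0 = {g \<in> carrier G. 0 < p g}"
  proof safe
    fix g assume "g \<in> carrier G" "0 < p g"
    then have "g \<otimes> inv s0 \<in> H" "g = (g \<otimes> inv s0) \<otimes> s0"
      using s0 by (auto simp: H_def m_assoc)
    then show "g \<in> H #> s0" by (auto simp: r_coset_def)
  qed (use s0 in \<open>auto simp: r_coset_def H_def\<close>)
qed

lemma (in prob_space) integrable_unit_interval:
  fixes f :: "'a \<Rightarrow> real"
  assumes "f \<in> borel_measurable M" "\<And>x. 0 \<le> f x" "\<And>x. f x \<le> 1"
  shows "integrable M f"
  using assms by (intro integrable_const_bound[of _ 1]) auto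

lemma (in prob_space) integrable_unit_interval_mult:
  fixes f g :: "'a \<Rightarrow> real"
  assumes "f \<in> borel_measurable M" "\<And>x. 0 \<le> f x" "\<And>x. f x \<le> 1"
    and "g \<in> borel_measurable M" "\<And>x. 0 \<le> g x" "\<And>x. g x \<le> 1"
  shows "integrable M (\<lambda>x. f x * g x)"
  using assms by (intro integrable_unit_interval borel_measurable_times mult_le_one mult_nonneg_nonneg)

lemma (in prob_space) AE_eq_0_of_integral_unit_interval:
  fixes f g :: "'a \<Rightarrow> real"
  assumes "f \<in> borel_measurable M" "\<And>x. 0 \<le> f x" "\<And>x. f x \<le> 1"
    and "g \<in> borel_measurable M" "\<And>x. 0 \<le> g x" "\<And>x. g x \<le> 1"
    and "(\<integral>x. f x * g x \<partial>M) = 0"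
  shows "AE x in M. f x * g x = 0"
  using integral_nonneg_eq_0_iff_AE[OF integrable_unit_interval_mult[OF assms(1-6)]] assms
  by simp

context group_ca_measure
begin

sublocale future: finite_measure_subalgebra \<mu> future
  by (rule finite_measure_subalgebra.intro[OF finite_measure_axioms])
    (simp add: finite_measure_subalgebra_axioms_def subalgebra_future)

abbreviation origin_event :: "'a \<Rightarrow> (nat \<Rightarrow> 'a) set" where
  "origin_event g \<equiv> {x \<in> space \<mu>. x 0 = g}"

lemma origin_event: "origin_event g \<in> sets \<mu>"
  by (rule simple_function_Collect_eq[OF simple_function_coordinate])

text \<open>A version of the conditional probability of the symbol at the origin, truncated so that the
  bounds hold everywhere.\<close>

definition symbol_prob :: "'a \<Rightarrow> (nat \<Rightarrow> 'a) \<Rightarrow> real" where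
  "symbol_prob g x = max 0 (min 1 (real_cond_exp \<mu> future (indicator (origin_event g)) x))"

lemma symbol_prob_bounds: "0 \<le> symbol_prob g x" "symbol_prob g x \<le> 1"
  by (auto simp: symbol_prob_def)

lemma symbol_prob_measurable_future: "symbol_prob g \<in> borel_measurable future"
  unfolding symbol_prob_def[abs_def] by measurable

lemma symbol_prob_measurable: "symbol_prob g \<in> borel_measurable \<mu>"
  by (rule measurable_from_subalg[OF subalgebra_future symbol_prob_measurable_future])

lemma integrable_origin_event: "integrable \<mu> (indicator (origin_event g) :: _ \<Rightarrow> real)"
  by (rule integrable_unit_interval[OF borel_measurable_indicator[OF origin_event]]) auto

lemma symbol_prob_AE:
  "AE x in \<mu>. real_cond_exp \<mu> future (indicator (origin_event g)) x = symbol_prob g x"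
proof -
  have "AE x in \<mu>. 0 \<le> real_cond_exp \<mu> future (indicator (origin_event g)) x"
    by (rule future.real_cond_exp_ge_c[OF integrable_origin_event]) auto
  moreover have "AE x in \<mu>. real_cond_exp \<mu> future (indicator (origin_event g)) x \<le> 1"
    by (rule future.real_cond_exp_le_c[OF integrable_origin_event]) auto
  ultimately show ?thesis by eventually_elim (auto simp: symbol_prob_def)
qed

text \<open>Truncation changes the conditional expectation only on a null set, so its defining
  property survives for bounded weights.\<close>

lemma integral_symbol_prob:
  assumes w: "w \<in> borel_measurable future" "\<And>x. 0 \<le> w x" "\<And>x. w x \<le> (1::real)"
  shows "(\<integral>x. w x * symbol_prob g x \<partial>\<mu>) = (\<integral>x. w x * indicator (origin_event g) x \<partial>\<mu>)"
proof -
  have wM[measurable]: "w \<in> borel_measurable \<mu>" by (rule measurable_from_subalg[OF subalgebra_future w(1)])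
  have [measurable]: "indicator (origin_event g) \<in> borel_measurable \<mu>" for g :: 'a
    by (rule borel_measurable_indicator[OF origin_event])
  note symbol_prob_measurable[measurable]
  have "(\<integral>x. w x * symbol_prob g x \<partial>\<mu>)
      = (\<integral>x. w x * real_cond_exp \<mu> future (indicator (origin_event g)) x \<partial>\<mu>)"
    using symbol_prob_AE[of g] by (intro integral_cong_AE) (auto elim!: eventually_mono)
  also have "\<dots> = (\<integral>x. w x * indicator (origin_event g) x \<partial>\<mu>)"
  proof (rule future.real_cond_exp_intg(2)[OF _ w(1)])
    show "integrable \<mu> (\<lambda>x. w x * indicator (origin_event g) x)"
      by (rule integrable_unit_interval_mult[OF wM w(2,3) borel_measurable_indicator[OF origin_event]]) auto
  qed measurable
  finally show ?thesis .
qed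

section \<open>Transformation of the conditional distribution under the automaton\<close>

lemma symbol_prob_compose_measurable:
  "(\<lambda>x. symbol_prob (f (x i)) x) \<in> borel_measurable \<mu>"
  by (rule measurable_compose_countable'[OF symbol_prob_measurable coordinate_measurable])
    (simp add: countable_finite finite_carrier)

text \<open>Both sides equal the integral of w times the indicator of tau(x)_0 = g, where w is
  \<open>symbol_prob g (group_ca G x)\<close>. On the left, w and x_1 depend on the future only, and
  tau(x)_0 = g means x_0 = g x_1^-1. On the right, invariance of the measure removes tau from both
  factors.\<close>

lemma symbol_prob_cross_integral:
  assumes g: "g \<in> carrier G"
  shows "(\<integral>x. symbol_prob (g \<otimes> inv (x 1)) x * symbol_prob g (group_ca G x) \<partial>\<mu>)
    = (\<integral>x. symbol_prob g x * symbol_prob g x \<partial>\<mu>)"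
proof -
  let ?w = "\<lambda>x. symbol_prob g (group_ca G x)"
  \<comment> \<open>The event x_1 = h is the shift preimage of x_0 = h, hence a future event.
    Splitting by h replaces the random index \<open>g \<otimes> inv (x 1)\<close> by a fixed
    one.\<close>
  let ?i = "\<lambda>h x. indicator (origin_event h) (shift x) :: real"
  have i_eq: "?i h x = (if x 1 = h then 1 else 0)" if "x \<in> space \<mu>" for h x
    using measure_preserving_space[OF shift that] by (auto simp: indicator_def shift_def)
  have wF: "?w \<in> borel_measurable future"
    by (rule measurable_compose[OF ca_measurable_future symbol_prob_measurable_future])
  have iF: "?i h \<in> borel_measurable future" for h
    by (rule measurable_compose[OF shift_measurable_future borel_measurable_indicator[OF origin_event]])
  have iwF: "(\<lambda>x. ?i h x * ?w x) \<in> borel_measurable future" for h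
    using iF wF by measurable
  have bounds: "0 \<le> ?i h x * ?w x" "?i h x * ?w x \<le> 1" for h x
    using symbol_prob_bounds[of g "group_ca G x"] by (auto simp: indicator_def)
  note iwM = measurable_from_subalg[OF subalgebra_future iwF]
  note [measurable] = symbol_prob_measurable
    borel_measurable_indicator[OF origin_event]
  have "(\<integral>x. symbol_prob (g \<otimes> inv (x 1)) x * ?w x \<partial>\<mu>)
      = (\<integral>x. (\<Sum>h\<in>carrier G. ?i h x * ?w x * symbol_prob (g \<otimes> inv h) x) \<partial>\<mu>)"
  proof (rule Bochner_Integration.integral_cong[OF refl])
    fix x assume x: "x \<in> space \<mu>"
    have "(\<Sum>h\<in>carrier G. ?i h x * ?w x * symbol_prob (g \<otimes> inv h) x)
        = (\<Sum>h\<in>carrier G. if x 1 = h then symbol_prob (g \<otimes> inv h) x * ?w x else 0)"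
      by (intro sum.cong) (auto simp: i_eq[OF x])
    then show "symbol_prob (g \<otimes> inv (x 1)) x * ?w x
        = (\<Sum>h\<in>carrier G. ?i h x * ?w x * symbol_prob (g \<otimes> inv h) x)"
      using x by (simp add: finite_carrier mem_space_iff)
  qed
  also have "\<dots> = (\<Sum>h\<in>carrier G. (\<integral>x. ?i h x * ?w x * symbol_prob (g \<otimes> inv h) x \<partial>\<mu>))"
    by (intro Bochner_Integration.integral_sum integrable_unit_interval_mult[OF iwM bounds]
        symbol_prob_measurable symbol_prob_bounds)
  also have "\<dots> = (\<Sum>h\<in>carrier G. (\<integral>x. ?i h x * ?w x * indicator (origin_event (g \<otimes> inv h)) x \<partial>\<mu>))"
    by (intro sum.cong refl integral_symbol_prob iwF bounds)
  also have "\<dots> = (\<integral>x. (\<Sum>h\<in>carrier G. ?i h x * ?w x * indicator (origin_event (g \<otimes> inv h)) x) \<partial>\<mu>)"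
    by (intro Bochner_Integration.integral_sum[symmetric] integrable_unit_interval_mult[OF iwM bounds]
        borel_measurable_indicator origin_event) auto
  also have "\<dots> = (\<integral>x. symbol_prob g (group_ca G x) * indicator (origin_event g) (group_ca G x) \<partial>\<mu>)"
  proof (rule Bochner_Integration.integral_cong[OF refl])
    fix x assume x: "x \<in> space \<mu>"
    have mem: "x 0 \<in> carrier G" "x 1 \<in> carrier G" using x by (auto simp: mem_space_iff)
    have "x 0 = g \<otimes> inv (x 1) \<longleftrightarrow> x 0 \<otimes> x 1 = g"
      using mem g by (metis inv_solve_right m_closed)
    then have "indicator (origin_event (g \<otimes> inv (x 1))) x = (indicator (origin_event g) (group_ca G x) :: real)"
      using x measure_preserving_space[OF ca x] by (simp add: indicator_def group_ca_def)
    moreover have "(\<Sum>h\<in>carrier G. ?i h x * ?w x * indicator (origin_event (g \<otimes> inv h)) x)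
        = (\<Sum>h\<in>carrier G. if x 1 = h then ?w x * indicator (origin_event (g \<otimes> inv h)) x else 0)"
      by (intro sum.cong) (auto simp: i_eq[OF x])
    ultimately show "(\<Sum>h\<in>carrier G. ?i h x * ?w x * indicator (origin_event (g \<otimes> inv h)) x)
        = symbol_prob g (group_ca G x) * indicator (origin_event g) (group_ca G x)"
      using mem by (simp add: finite_carrier)
  qed
  also have "\<dots> = (\<integral>x. symbol_prob g x * indicator (origin_event g) x \<partial>distr \<mu> \<mu> (group_ca G))"
    by (rule integral_distr[OF ca_measurable, symmetric]) measurable
  also have "distr \<mu> \<mu> (group_ca G) = \<mu>"
    using ca by (simp add: measure_preserving_def)
  also have "(\<integral>x. symbol_prob g x * indicator (origin_event g) x \<partial>\<mu>) = (\<integral>x. symbol_prob g x * symbol_prob g x \<partial>\<mu>)"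
    by (rule integral_symbol_prob[symmetric]) (auto simp: symbol_prob_bounds symbol_prob_measurable_future)
  finally show ?thesis .
qed

text \<open>The squared L2 distance, summed over g, is expanded. For each g, the cross term and the
  norm of \<open>?w g\<close> reduce to the norm of \<open>symbol_prob g\<close>. For
  \<open>?a g\<close> this holds only after summation, because g -> g x_1^-1 permutes the
  group.\<close>

lemma symbol_prob_ca:
  "AE x in \<mu>. \<forall>g\<in>carrier G. symbol_prob g (group_ca G x) = symbol_prob (g \<otimes> inv (x 1)) x"
proof -
  let ?a = "\<lambda>g x. symbol_prob (g \<otimes> inv (x 1)) x"
  let ?w = "\<lambda>g x. symbol_prob g (group_ca G x)"
  have a[measurable]: "?a g \<in> borel_measurable \<mu>" for g by (rule symbol_prob_compose_measurable)
  have w[measurable]: "?w g \<in> borel_measurable \<mu>" for g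
    by (rule measurable_compose[OF ca_measurable symbol_prob_measurable])
  note [measurable] = symbol_prob_measurable
  have int: "integrable \<mu> (\<lambda>x. ?a g x * ?a g x)" "integrable \<mu> (\<lambda>x. ?a g x * ?w g x)"
    "integrable \<mu> (\<lambda>x. ?w g x * ?w g x)" "integrable \<mu> (\<lambda>x. symbol_prob g x * symbol_prob g x)" for g
    by (rule integrable_unit_interval_mult; (rule a w symbol_prob_measurable symbol_prob_bounds))+
  have sq: "(?a g x - ?w g x)\<^sup>2 = ?a g x * ?a g x - 2 * (?a g x * ?w g x) + ?w g x * ?w g x" for g x
    by (simp add: power2_eq_square algebra_simps)
  have int_sq: "integrable \<mu> (\<lambda>x. (?a g x - ?w g x)\<^sup>2)" for g
    unfolding sq using int[of g] by (intro Bochner_Integration.integrable_add Bochner_Integration.integrable_diff integrable_mult_right)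
  have "(\<Sum>g\<in>carrier G. (\<integral>x. ?a g x * ?a g x \<partial>\<mu>)) = (\<integral>x. (\<Sum>g\<in>carrier G. ?a g x * ?a g x) \<partial>\<mu>)"
    using int by (intro Bochner_Integration.integral_sum[symmetric])
  also have "\<dots> = (\<integral>x. (\<Sum>g\<in>carrier G. symbol_prob g x * symbol_prob g x) \<partial>\<mu>)"
  proof (rule Bochner_Integration.integral_cong[OF refl])
    fix x assume "x \<in> space \<mu>"
    then have c: "inv (x 1) \<in> carrier G" by (simp add: mem_space_iff)
    have "bij_betw (\<lambda>g. g \<otimes> inv (x 1)) (carrier G) (carrier G)"
    proof (rule bij_betw_byWitness[of _ "\<lambda>g. g \<otimes> inv (inv (x 1))"])
    qed (use c in \<open>auto simp: m_assoc\<close>)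
    from sum.reindex_bij_betw[OF this, of "\<lambda>g. symbol_prob g x * symbol_prob g x"]
    show "(\<Sum>g\<in>carrier G. ?a g x * ?a g x) = (\<Sum>g\<in>carrier G. symbol_prob g x * symbol_prob g x)" .
  qed
  also have "\<dots> = (\<Sum>g\<in>carrier G. (\<integral>x. symbol_prob g x * symbol_prob g x \<partial>\<mu>))"
    using int by (intro Bochner_Integration.integral_sum)
  finally have aa: "(\<Sum>g\<in>carrier G. (\<integral>x. ?a g x * ?a g x \<partial>\<mu>)) = (\<Sum>g\<in>carrier G. (\<integral>x. symbol_prob g x * symbol_prob g x \<partial>\<mu>))" .
  have ww: "(\<integral>x. ?w g x * ?w g x \<partial>\<mu>) = (\<integral>x. symbol_prob g x * symbol_prob g x \<partial>\<mu>)" for g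
  proof -
    have "(\<integral>x. symbol_prob g x * symbol_prob g x \<partial>distr \<mu> \<mu> (group_ca G)) = (\<integral>x. ?w g x * ?w g x \<partial>\<mu>)"
      by (rule integral_distr[OF ca_measurable]) measurable
    moreover have "distr \<mu> \<mu> (group_ca G) = \<mu>" using ca by (simp add: measure_preserving_def)
    ultimately show ?thesis by simp
  qed
  have "(\<integral>x. (\<Sum>g\<in>carrier G. (?a g x - ?w g x)\<^sup>2) \<partial>\<mu>) = (\<Sum>g\<in>carrier G. (\<integral>x. (?a g x - ?w g x)\<^sup>2 \<partial>\<mu>))"
    using int_sq by (intro Bochner_Integration.integral_sum)
  also have "\<dots> = (\<Sum>g\<in>carrier G. (\<integral>x. ?a g x * ?a g x \<partial>\<mu>) - 2 * (\<integral>x. ?a g x * ?w g x \<partial>\<mu>) + (\<integral>x. ?w g x * ?w g x \<partial>\<mu>))"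
    unfolding sq using int by simp
  also have "\<dots> = (\<Sum>g\<in>carrier G. (\<integral>x. ?a g x * ?a g x \<partial>\<mu>)) - (\<Sum>g\<in>carrier G. (\<integral>x. symbol_prob g x * symbol_prob g x \<partial>\<mu>))"
    unfolding sum_subtractf[symmetric] by (intro sum.cong) (simp_all add: symbol_prob_cross_integral ww del: One_nat_def)
  also have "\<dots> = 0" unfolding aa by simp
  finally have zero: "(\<integral>x. (\<Sum>g\<in>carrier G. (?a g x - ?w g x)\<^sup>2) \<partial>\<mu>) = 0" .
  have "AE x in \<mu>. (\<Sum>g\<in>carrier G. (?a g x - ?w g x)\<^sup>2) = 0"
    by (rule iffD1[OF integral_nonneg_eq_0_iff_AE zero])
      (rule Bochner_Integration.integrable_sum int_sq AE_I2 sum_nonneg zero_le_power2)+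
  then show ?thesis
    by eventually_elim (simp add: sum_nonneg_eq_0_iff finite_carrier)
qed

text \<open>As tau(x)_0 = x_0 x_1, the translation by x_1^-1 is absorbed when the distribution is
  recentred at the symbol at the origin.\<close>

lemma symbol_prob_translate_ca_invariant:
  "AE x in \<mu>. \<forall>g\<in>carrier G. symbol_prob (g \<otimes> group_ca G x 0) (group_ca G x) = symbol_prob (g \<otimes> x 0) x"
  using symbol_prob_ca AE_space
proof eventually_elim
  case (elim x)
  show ?case
  proof
    fix g assume g: "g \<in> carrier G"
    have mem: "x 0 \<in> carrier G" "x 1 \<in> carrier G" using elim(2) by (auto simp: mem_space_iff)
    have "symbol_prob (g \<otimes> (x 0 \<otimes> x 1)) (group_ca G x) = symbol_prob (g \<otimes> (x 0 \<otimes> x 1) \<otimes> inv (x 1)) x"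
      using elim(1) g mem by simp
    also have "g \<otimes> (x 0 \<otimes> x 1) \<otimes> inv (x 1) = g \<otimes> x 0"
      using g mem by (simp add: m_assoc)
    finally show "symbol_prob (g \<otimes> group_ca G x 0) (group_ca G x) = symbol_prob (g \<otimes> x 0) x"
      by (simp add: group_ca_def)
  qed
qed

text \<open>This transfers statements from the points with x_0 = s to all points where s has
  positive conditional probability, provided that the exceptional set D depends on the future
  only.\<close>

lemma symbol_prob_eq_0:
  assumes D: "D \<in> sets future" and null: "AE x in \<mu>. x \<in> D \<longrightarrow> x 0 \<noteq> s"
  shows "AE x in \<mu>. x \<in> D \<longrightarrow> symbol_prob s x = 0"
proof -
  have iD: "indicator D \<in> borel_measurable future" by (rule borel_measurable_indicator[OF D])
  have "(\<integral>x. indicator D x * symbol_prob s x \<partial>\<mu>) = (\<integral>x. indicator D x * indicator (origin_event s) x \<partial>\<mu>)"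
    using iD by (intro integral_symbol_prob) auto
  also have "\<dots> = 0"
    using null by (intro integral_eq_zero_AE) (auto elim!: eventually_mono simp: indicator_def)
  finally have "AE x in \<mu>. indicator D x * symbol_prob s x = 0"
    by (intro AE_eq_0_of_integral_unit_interval measurable_from_subalg[OF subalgebra_future iD]
        symbol_prob_measurable symbol_prob_bounds) auto
  then show ?thesis by eventually_elim (auto simp: indicator_def split: if_splits)
qed

text \<open>The event that \<open>symbol_prob s\<close> vanishes is a future event, and the
  probability that x_0 = s on it is the integral of \<open>symbol_prob s\<close> over it, which is
  0.\<close>

lemma symbol_prob_pos: "AE x in \<mu>. 0 < symbol_prob (x 0) x"
proof -
  have "AE x in \<mu>. x 0 = s \<longrightarrow> 0 < symbol_prob s x" for s
  proof -
    define D where "D = {x \<in> space future. symbol_prob s x = 0}"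
    have D: "D \<in> sets future"
      unfolding D_def using symbol_prob_measurable_future[of s] by measurable
    have iD: "indicator D \<in> borel_measurable future" by (rule borel_measurable_indicator[OF D])
    have "(\<integral>x. indicator D x * indicator (origin_event s) x \<partial>\<mu>) = (\<integral>x. indicator D x * symbol_prob s x \<partial>\<mu>)"
      using iD by (intro integral_symbol_prob[symmetric]) auto
    also have "\<dots> = 0"
      by (intro integral_eq_zero_AE AE_I2) (auto simp: D_def indicator_def)
    finally have "AE x in \<mu>. indicator D x * indicator (origin_event s) x = (0::real)"
      by (intro AE_eq_0_of_integral_unit_interval measurable_from_subalg[OF subalgebra_future iD]
          borel_measurable_indicator origin_event) auto
    then show ?thesis
      using AE_space
    proof eventually_elim
      case (elim x)
      then show ?case
        using symbol_prob_bounds(1)[of s x] by (auto simp: D_def indicator_def order_less_le split: if_splits)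
    qed
  qed
  then have "AE x in \<mu>. \<forall>s\<in>carrier G. x 0 = s \<longrightarrow> 0 < symbol_prob s x"
    by (intro AE_finite_allI finite_carrier)
  then show ?thesis using AE_space by eventually_elim (auto simp: mem_space_iff)
qed

text \<open>The event r < p_x(g x_0) is almost surely tau-invariant, hence agrees with a future
  event \<open>A' g r\<close>. Where x_0 = s, this event decides whether r < p_x(g s). Both
  conditions depend on the future only, so they agree wherever p_x(s) > 0. Rational levels r then
  separate the values.\<close>

lemma symbol_prob_quasi_invariant:
  "AE x in \<mu>. \<forall>g\<in>carrier G. \<forall>s\<in>carrier G. \<forall>s'\<in>carrier G.
    0 < symbol_prob s x \<longrightarrow> 0 < symbol_prob s' x \<longrightarrow> symbol_prob (g \<otimes> s) x = symbol_prob (g \<otimes> s') x"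
proof -
  have "\<exists>A'\<in>sets future. AE x in \<mu>. real_of_rat r < symbol_prob (g \<otimes> x 0) x \<longleftrightarrow> x \<in> A'"
    if g: "g \<in> carrier G" for g r
  proof -
    define A where "A = {x \<in> space \<mu>. real_of_rat r < symbol_prob (g \<otimes> x 0) x}"
    have A: "A \<in> sets \<mu>"
      unfolding A_def using symbol_prob_compose_measurable[of "\<lambda>h. g \<otimes> h" 0] by measurable
    have "AE x in \<mu>. group_ca G x \<in> A \<longleftrightarrow> x \<in> A"
      using symbol_prob_translate_ca_invariant AE_space
      by eventually_elim (simp add: A_def g measure_preserving_space[OF ca])
    from AE_future_measurable_of_ca_invariant(2)[OF A this]
    obtain A' where "A' \<in> sets future" "AE x in \<mu>. x \<in> A \<longleftrightarrow> x \<in> A'" by blast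
    moreover have "AE x in \<mu>. real_of_rat r < symbol_prob (g \<otimes> x 0) x \<longleftrightarrow> x \<in> A'"
      using calculation(2) AE_space by eventually_elim (auto simp: A_def)
    ultimately show ?thesis by blast
  qed
  note ex = this
  \<comment> \<open>One event has to serve for all s in the support, so it is chosen before s is
    introduced.\<close>
  define A' where "A' g r = (SOME A'. A' \<in> sets future \<and>
    (AE x in \<mu>. real_of_rat r < symbol_prob (g \<otimes> x 0) x \<longleftrightarrow> x \<in> A'))" for g r
  have "A' g r \<in> sets future \<and> (AE x in \<mu>. real_of_rat r < symbol_prob (g \<otimes> x 0) x \<longleftrightarrow> x \<in> A' g r)"
    if "g \<in> carrier G" for g r
    unfolding A'_def using ex[OF that, of r] unfolding Bex_def by (rule someI_ex)
  then have A': "\<And>g r. g \<in> carrier G \<Longrightarrow> A' g r \<in> sets future"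
    and A'_AE: "\<And>g r. g \<in> carrier G \<Longrightarrow> AE x in \<mu>. real_of_rat r < symbol_prob (g \<otimes> x 0) x \<longleftrightarrow> x \<in> A' g r"
    by blast+
  have "AE x in \<mu>. 0 < symbol_prob s x \<longrightarrow> (real_of_rat r < symbol_prob (g \<otimes> s) x \<longleftrightarrow> x \<in> A' g r)"
    if g: "g \<in> carrier G" for g s r
  proof -
    define D where "D = {x \<in> space future. (real_of_rat r < symbol_prob (g \<otimes> s) x) \<noteq> (x \<in> A' g r)}"
    have "D \<in> sets future"
      unfolding D_def using symbol_prob_measurable_future[of "g \<otimes> s"] A'[OF g, of r] by measurable
    moreover have "AE x in \<mu>. x \<in> D \<longrightarrow> x 0 \<noteq> s"
      using A'_AE[OF g, of r] by eventually_elim (auto simp: D_def)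
    ultimately have "AE x in \<mu>. x \<in> D \<longrightarrow> symbol_prob s x = 0"
      by (rule symbol_prob_eq_0)
    then show ?thesis using AE_space by eventually_elim (auto simp: D_def)
  qed
  then have "AE x in \<mu>. \<forall>r. \<forall>g\<in>carrier G. \<forall>s\<in>carrier G.
      0 < symbol_prob s x \<longrightarrow> (real_of_rat r < symbol_prob (g \<otimes> s) x \<longleftrightarrow> x \<in> A' g r)"
    unfolding AE_all_countable by (intro allI AE_finite_allI finite_carrier)
  then show ?thesis
  proof eventually_elim
    case (elim x)
    show ?case
    proof (intro ballI impI)
      fix g s s' assume mem: "g \<in> carrier G" "s \<in> carrier G" "s' \<in> carrier G"
        and pos: "0 < symbol_prob s x" "0 < symbol_prob s' x"
      have iff: "real_of_rat r < symbol_prob (g \<otimes> s) x \<longleftrightarrow> real_of_rat r < symbol_prob (g \<otimes> s') x" for r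
        using elim mem pos by blast
      show "symbol_prob (g \<otimes> s) x = symbol_prob (g \<otimes> s') x"
      proof (rule ccontr)
        assume "symbol_prob (g \<otimes> s) x \<noteq> symbol_prob (g \<otimes> s') x"
        then consider "symbol_prob (g \<otimes> s) x < symbol_prob (g \<otimes> s') x" | "symbol_prob (g \<otimes> s') x < symbol_prob (g \<otimes> s) x"
          by linarith
        then show False
        proof cases
          case 1
          then obtain r where "symbol_prob (g \<otimes> s) x < real_of_rat r" "real_of_rat r < symbol_prob (g \<otimes> s') x"
            using of_rat_dense by blast
          then show False using iff[of r] by simp
        next
          case 2
          then obtain r where "symbol_prob (g \<otimes> s') x < real_of_rat r" "real_of_rat r < symbol_prob (g \<otimes> s) x"
            using of_rat_dense by blast
          then show False using iff[of r] by simp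
        qed
      qed
    qed
  qed
qed

section \<open>The subgroup attached to a point\<close>

definition translated_support :: "(nat \<Rightarrow> 'a) \<Rightarrow> 'a set" where
  "translated_support x = {h \<in> carrier G. 0 < symbol_prob (h \<otimes> x 0) x}"

text \<open>The translated support is a subgroup only almost surely. The trivial group as default
  value makes the subgroup property hold everywhere, and invariance and measurability still pass
  over from the translated support.\<close>

definition coset_group :: "(nat \<Rightarrow> 'a) \<Rightarrow> 'a set" where
  "coset_group x = (if subgroup (translated_support x) G then translated_support x else {\<one>})"

lemma subgroup_coset_group: "subgroup (coset_group x) G"
  by (simp add: coset_group_def triv_subgroup)

lemma coset_group_ca_invariant: "AE x in \<mu>. coset_group (group_ca G x) = coset_group x"
  using symbol_prob_translate_ca_invariant
proof eventually_elim
  case (elim x)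
  then have "translated_support (group_ca G x) = translated_support x"
    by (auto simp: translated_support_def)
  then show ?case by (simp add: coset_group_def)
qed

lemma coset_group_measurable: "{x \<in> space \<mu>. coset_group x = K} \<in> sets \<mu>"
proof -
  have meas: "translated_support \<in> \<mu> \<rightarrow>\<^sub>M count_space (Pow (carrier G))"
  proof (subst measurable_count_space_eq2)
    show "finite (Pow (carrier G))" using finite_carrier by simp
    have "translated_support -` {L} \<inter> space \<mu> \<in> sets \<mu>" if "L \<subseteq> carrier G" for L
    proof -
      have "translated_support -` {L} \<inter> space \<mu>
          = {x \<in> space \<mu>. \<forall>h\<in>carrier G. (0 < symbol_prob (h \<otimes> x 0) x) = (h \<in> L)}"
        using that unfolding translated_support_def by blast
      also have "\<dots> \<in> sets \<mu>"
      proof (rule sets.sets_Collect_finite_All'[OF _ finite_carrier])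
        show "{x \<in> space \<mu>. (0 < symbol_prob (h \<otimes> x 0) x) = (h \<in> L)} \<in> sets \<mu>" for h
          using symbol_prob_compose_measurable[of "\<lambda>k. h \<otimes> k" 0] by measurable
      qed (use one_closed in blast)
      finally show ?thesis .
    qed
    then show "translated_support \<in> space \<mu> \<rightarrow> Pow (carrier G) \<and>
      (\<forall>L\<in>Pow (carrier G). translated_support -` {L} \<inter> space \<mu> \<in> sets \<mu>)"
      by (auto simp: translated_support_def)
  qed
  have "translated_support -` {L \<in> Pow (carrier G). (if subgroup L G then L else {\<one>}) = K} \<inter> space \<mu> \<in> sets \<mu>"
    by (rule measurable_sets[OF meas]) auto
  also have "translated_support -` {L \<in> Pow (carrier G). (if subgroup L G then L else {\<one>}) = K} \<inter> space \<mu>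
      = {x \<in> space \<mu>. coset_group x = K}"
    by (auto simp: coset_group_def translated_support_def)
  finally show ?thesis .
qed

text \<open>There are finitely many subgroups, so it suffices to treat level sets. Each is almost
  surely tau-invariant and is therefore itself a set of zero entropy.\<close>

lemma coset_group_pinsker: "coset_group \<in> pinsker_algebra \<mu> (group_ca G) \<rightarrow>\<^sub>M count_space {K. subgroup K G}"
proof -
  let ?P = "{A \<in> sets \<mu>. dynamical_entropy \<mu> (group_ca G) (\<lambda>x. x \<in> A) = 0}"
  have sub: "?P \<subseteq> Pow (space \<mu>)" using sets.sets_into_space by blast
  have sp: "space (pinsker_algebra \<mu> (group_ca G)) = space \<mu>"
    unfolding pinsker_algebra_def by (rule space_measure_of[OF sub])
  have sets: "sets (pinsker_algebra \<mu> (group_ca G)) = sigma_sets (space \<mu>) ?P"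
    unfolding pinsker_algebra_def by (rule sets_measure_of[OF sub])
  have "finite {K. subgroup K G}"
    by (rule finite_subset[of _ "Pow (carrier G)"]) (use finite_carrier in \<open>auto dest: subgroup.subset\<close>)
  then show ?thesis
  proof (subst measurable_count_space_eq2)
    have "coset_group -` {K} \<inter> space \<mu> \<in> sigma_sets (space \<mu>) ?P" for K
    proof (rule sigma_sets.Basic)
      have eq: "coset_group -` {K} \<inter> space \<mu> = {x \<in> space \<mu>. coset_group x = K}" by auto
      have "AE x in \<mu>. group_ca G x \<in> {x \<in> space \<mu>. coset_group x = K} \<longleftrightarrow> x \<in> {x \<in> space \<mu>. coset_group x = K}"
        using coset_group_ca_invariant AE_space
        by eventually_elim (simp add: measure_preserving_space[OF ca])
      from AE_future_measurable_of_ca_invariant(1)[OF coset_group_measurable this] coset_group_measurable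
      show "coset_group -` {K} \<inter> space \<mu> \<in> ?P" unfolding eq by simp
    qed
    then show "coset_group \<in> space (pinsker_algebra \<mu> (group_ca G)) \<rightarrow> {K. subgroup K G} \<and>
      (\<forall>K\<in>{K. subgroup K G}. coset_group -` {K} \<inter> space (pinsker_algebra \<mu> (group_ca G)) \<in> sets (pinsker_algebra \<mu> (group_ca G)))"
      unfolding sp sets by (auto simp: subgroup_coset_group)
  qed
qed

text \<open>The carrier is finite, so any version \<open>\<kappa>\<close> gives the masses
  \<open>symbol_prob g x\<close> for all g simultaneously, almost surely. The coset is the support H
  x_0 of this distribution.\<close>

lemma conditional_measure_uniform:
  assumes \<kappa>: "is_conditional_measure \<mu> future \<kappa>"
  shows "AE x in \<mu>. \<exists>C \<in> rcosets (coset_group x).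
    distr (\<kappa> x) (count_space (carrier G)) (\<lambda>y. y 0) = uniform_measure (count_space (carrier G)) C"
proof -
  have "AE x in \<mu>. prob_space (\<kappa> x) \<and> sets (\<kappa> x) = sets \<mu>"
    using \<kappa> by (simp add: is_conditional_measure_def)
  moreover have "AE x in \<mu>. \<forall>g\<in>carrier G. measure (\<kappa> x) (origin_event g) = symbol_prob g x"
  proof (intro AE_finite_allI finite_carrier)
    fix g
    have "AE x in \<mu>. measure (\<kappa> x) (origin_event g) = real_cond_exp \<mu> future (indicator (origin_event g)) x"
      using \<kappa> origin_event by (simp add: is_conditional_measure_def)
    then show "AE x in \<mu>. measure (\<kappa> x) (origin_event g) = symbol_prob g x"
      using symbol_prob_AE[of g] by eventually_elim simp
  qed
  ultimately show ?thesis
    using symbol_prob_pos symbol_prob_quasi_invariant AE_space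
  proof eventually_elim
    case (elim x)
    then interpret \<kappa>: prob_space "\<kappa> x" by simp
    have sets: "sets (\<kappa> x) = sets \<mu>" and space: "space (\<kappa> x) = space \<mu>"
      using elim(1) sets_eq_imp_space_eq by blast+
    have x0: "x 0 \<in> carrier G" using elim(5) by (simp add: mem_space_iff)
    define S where "S = {g \<in> carrier G. 0 < symbol_prob g x}"
    have const: "symbol_prob (g \<otimes> s) x = symbol_prob (g \<otimes> s') x"
      if "g \<in> carrier G" "s \<in> carrier G" "s' \<in> carrier G" "0 < symbol_prob s x" "0 < symbol_prob s' x" for g s s'
      using elim(4) that by blast
    have sub: "subgroup (translated_support x) G" and coset: "translated_support x #> x 0 = S"
      unfolding translated_support_def S_def
      using coset_of_quasi_invariant[of "x 0" "\<lambda>g. symbol_prob g x", OF x0 elim(3) const] by auto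
    have S: "S \<in> rcosets (coset_group x)"
      using rcosetsI[of "translated_support x" "x 0"] subgroup.subset[OF sub] sub x0 coset
      by (auto simp: coset_group_def)
    have S_sub: "S \<subseteq> carrier G" and x0_S: "x 0 \<in> S" using x0 elim(3) by (auto simp: S_def)
    then have finS: "finite S" using finite_carrier finite_subset by blast
    \<comment> \<open>Quasi-invariance with g = \<open>\<one>\<close> makes the distribution
      constant on its support. Total mass 1 then fixes the value as 1 / card S.\<close>
    have eq: "symbol_prob g x = symbol_prob (x 0) x" if "g \<in> S" for g
      using const[of \<one> g "x 0"] that x0 elim(3) by (auto simp: S_def)
    have "1 = measure (\<kappa> x) (\<Union>g\<in>carrier G. origin_event g)"
    proof -
      have "(\<Union>g\<in>carrier G. origin_event g) = space (\<kappa> x)" unfolding space by (auto simp: mem_space_iff)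
      then show ?thesis by (simp add: \<kappa>.prob_space)
    qed
    also have "\<dots> = (\<Sum>g\<in>carrier G. measure (\<kappa> x) (origin_event g))"
      using origin_event by (intro \<kappa>.finite_measure_finite_Union finite_carrier) (auto simp: sets disjoint_family_on_def)
    also have "\<dots> = (\<Sum>g\<in>carrier G. symbol_prob g x)"
      using elim(2) by simp
    also have "\<dots> = (\<Sum>g\<in>S. symbol_prob g x)"
      using S_sub symbol_prob_bounds(1)[of _ x]
      by (intro sum.mono_neutral_right finite_carrier) (auto simp: S_def order_less_le)
    also have "\<dots> = real (card S) * symbol_prob (x 0) x" using eq by simp
    finally have card: "symbol_prob (x 0) x = 1 / real (card S)"
      using finS x0_S card_gt_0_iff[of S] by (auto simp: eq_divide_eq mult.commute)
    have meas: "(\<lambda>y. y 0) \<in> \<kappa> x \<rightarrow>\<^sub>M count_space (carrier G)"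
      using coordinate_measurable[of 0] by (simp add: measurable_cong_sets[OF sets refl])
    have "distr (\<kappa> x) (count_space (carrier G)) (\<lambda>y. y 0) = uniform_measure (count_space (carrier G)) S"
    proof (rule measure_eqI_finite[OF _ _ finite_carrier])
      fix g assume g: "g \<in> carrier G"
      have "emeasure (distr (\<kappa> x) (count_space (carrier G)) (\<lambda>y. y 0)) {g}
          = emeasure (\<kappa> x) ((\<lambda>y. y 0) -` {g} \<inter> space (\<kappa> x))"
        using g by (intro emeasure_distr[OF meas]) simp
      also have "(\<lambda>y. y 0) -` {g} \<inter> space (\<kappa> x) = origin_event g" by (auto simp: space)
      also have "emeasure (\<kappa> x) (origin_event g) = ennreal (symbol_prob g x)"
        using elim(2) g by (simp add: \<kappa>.emeasure_eq_measure)
      also have "symbol_prob g x = (if g \<in> S then 1 / real (card S) else 0)"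
        using eq[of g] card g symbol_prob_bounds(1)[of g x] by (auto simp: S_def order_less_le)
      also have "ennreal \<dots> = emeasure (count_space (carrier G)) (S \<inter> {g}) / emeasure (count_space (carrier G)) S"
        using S_sub finS x0_S card_gt_0_iff[of S]
        by (auto simp: emeasure_count_space divide_ennreal ennreal_of_nat_eq_real_of_nat
            simp flip: ennreal_1 simp del: ennreal_eq_1)
      also have "\<dots> = emeasure (uniform_measure (count_space (carrier G)) S) {g}"
        using S_sub g by (intro emeasure_uniform_measure[symmetric]) auto
      finally show "emeasure (distr (\<kappa> x) (count_space (carrier G)) (\<lambda>y. y 0)) {g}
          = emeasure (uniform_measure (count_space (carrier G)) S) {g}" .
    qed simp_all
    with S show ?case by blast
  qed
qed

end

theorem theorem5p1:
  fixes G :: "('a, 'b) monoid_scheme" and \<mu> :: "(nat \<Rightarrow> 'a) measure"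
  assumes "group G" and "finite (carrier G)"
    and "prob_space \<mu>" and "sets \<mu> = sets (config_space G)"
    and "measure_preserving \<mu> shift" and "measure_preserving \<mu> (group_ca G)"
  shows "sets (pinsker_algebra \<mu> shift) = sets (pinsker_algebra \<mu> (group_ca G)) \<and>
    (\<exists>H. (\<forall>x\<in>space \<mu>. subgroup (H x) G) \<and>
      (\<forall>\<kappa>. is_conditional_measure \<mu> (vimage_algebra (space \<mu>) shift \<mu>) \<kappa> \<longrightarrow>
        (AE x in \<mu>. \<exists>C \<in> rcosets\<^bsub>G\<^esub> (H x).
           distr (\<kappa> x) (count_space (carrier G)) (\<lambda>y. y 0)
             = uniform_measure (count_space (carrier G)) C)) \<and>
      (AE x in \<mu>. H (group_ca G x) = H x) \<and>
      H \<in> pinsker_algebra \<mu> shift \<rightarrow>\<^sub>M count_space {K. subgroup K G} \<and>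
      H \<in> pinsker_algebra \<mu> (group_ca G) \<rightarrow>\<^sub>M count_space {K. subgroup K G})"
proof -
  interpret group_ca_measure G \<mu>
    using assms by (simp add: group_ca_measure_def group_ca_measure_axioms_def)
  show ?thesis
    unfolding pinsker_algebra_shift_eq_ca
    using subgroup_coset_group conditional_measure_uniform coset_group_ca_invariant coset_group_pinsker
    by (intro conjI refl exI[of _ coset_group]) auto
qed

end
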